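(* Let $\mathcal{G}$ be a network with no nodes embedded on an annulus, equipped with a flat $\mathbb{C}^*$-connection with monodromy $z\in\mathbb{C}^*$ around a loop generating the fundamental group of the annulus, and let $P(z)=\det\Delta$ be the determinant of the associated line bundle Laplacian, a Laurent polynomial in $z$. Then $P$ is reciprocal, i.e. $P(z)=P(1/z)$, and the roots of $P$ are real, positive, and distinct except for a double root at $z=1$.
   Context: A network is a connected finite graph $\mathcal{G}=(V,E)$ (multi-edges and self-loops allowed) with a positive conductance $c_e$ on each edge; it has no nodes when no vertices are designated as boundary vertices. A line bundle with connection on $\mathcal{G}$ assigns a copy of $\mathbb{C}$ to each vertex and to each oriented edge from $v$ to $v'$ a parallel transport $\phi_{vv'}\in\mathbb{C}^*$, with $\phi_{v'v}=\phi_{vv'}^{-1}$. The monodromy of an oriented cycle is the product of the parallel transports along it. For a graph embedded on an annulus the connection is flat if every cycle that is contractible in the annulus has monodromy $1$; thus non-contractible simple cycles have monodromy $z$ or $z^{-1}$, where $z$ is the monodromy of a generator of $\pi_1$. The Laplacian is the operator on $\mathbb{C}^V$ given by $$(\Delta f)(v)=\sum_{v'\sim v}c_{vv'}\bigl(f(v)-\phi_{v'v}f(v')\bigr),$$ the sum being over edges at $v$ (with multiplicity). A self-loop at $v$ with conductance $c$ and monodromy $w$ contributes in both orientations, i.e. contributes $c(2-w-w^{-1})f(v)$. The determinant depends on the connection only through $z$.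
   Formalization: The claim about the roots is made for networks containing a cycle that is non-contractible in the annulus; otherwise (e.g. a tree) the determinant P is identically zero and the claim about its roots fails. Reciprocity is stated for all networks. *)

theory Defs
  imports "HOL-Complex_Analysis.Complex_Analysis"
begin

section \<open>Networks\<close>

text \<open>
  The vertex set is the whole finite type \<open>'v\<close>.  Every edge carries an arbitrary reference
  orientation from \<open>tail\<close> to \<open>head\<close>; multi-edges and self-loops are allowed.
\<close>

record ('v, 'e) network =
  edges :: "'e set"
  tail :: "'e \<Rightarrow> 'v"
  head :: "'e \<Rightarrow> 'v"
  conductance :: "'e \<Rightarrow> real"

text \<open>
  A dart is an oriented edge: \<open>(e, True)\<close> runs along the reference orientation and \<open>(e, False)\<close>
  against it.  In particular a self-loop gives two darts, both starting at the same vertex.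
\<close>

type_synonym 'e dart = "'e \<times> bool"

definition darts :: "('v, 'e) network \<Rightarrow> 'e dart set" where
  "darts N = edges N \<times> UNIV"

definition rev_dart :: "'e dart \<Rightarrow> 'e dart" where
  "rev_dart d = (fst d, \<not> snd d)"

definition dart_tail :: "('v, 'e) network \<Rightarrow> 'e dart \<Rightarrow> 'v" where
  "dart_tail N d = (if snd d then tail N (fst d) else head N (fst d))"

definition dart_head :: "('v, 'e) network \<Rightarrow> 'e dart \<Rightarrow> 'v" where
  "dart_head N d = (if snd d then head N (fst d) else tail N (fst d))"

fun walk :: "('v, 'e) network \<Rightarrow> 'v \<Rightarrow> 'e dart list \<Rightarrow> 'v \<Rightarrow> bool" where
  "walk N u [] v \<longleftrightarrow> u = v"
| "walk N u (d # ds) v \<longleftrightarrow> d \<in> darts N \<and> dart_tail N d = u \<and> walk N (dart_head N d) ds v"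

definition is_network :: "('v::finite, 'e) network \<Rightarrow> bool" where
  "is_network N \<longleftrightarrow>
     finite (edges N) \<and> (\<forall>e\<in>edges N. conductance N e > 0) \<and> (\<forall>u v. \<exists>ds. walk N u ds v)"

section \<open>Connections and the line bundle Laplacian\<close>

text \<open>\<open>\<phi> d\<close> is the parallel transport from the tail of \<open>d\<close> to its head.\<close>

definition connection :: "('v, 'e) network \<Rightarrow> ('e dart \<Rightarrow> complex) \<Rightarrow> bool" where
  "connection N \<phi> \<longleftrightarrow> (\<forall>d\<in>darts N. \<phi> d \<noteq> 0 \<and> \<phi> (rev_dart d) = inverse (\<phi> d))"

definition monodromy :: "('e dart \<Rightarrow> complex) \<Rightarrow> 'e dart list \<Rightarrow> complex" where
  "monodromy \<phi> ds = prod_list (map \<phi> ds)"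

text \<open>
  The sum runs over the darts leaving \<open>v\<close>, so that a self-loop contributes in both orientations.
\<close>

definition laplacian ::
  "('v::finite, 'e) network \<Rightarrow> ('e dart \<Rightarrow> complex) \<Rightarrow> complex ^ 'v \<Rightarrow> complex ^ 'v" where
  "laplacian N \<phi> f =
     (\<chi> v. \<Sum>d\<in>{d \<in> darts N. dart_tail N d = v}.
             complex_of_real (conductance N (fst d)) *
               (f $ v - \<phi> (rev_dart d) * f $ dart_head N d))"

section \<open>Embeddings in an annulus\<close>

definition annulus :: "real \<Rightarrow> real \<Rightarrow> complex set" where
  "annulus r R = {x. r \<le> cmod x \<and> cmod x \<le> R}"

text \<open>
  The vertex \<open>v\<close> is drawn at the point \<open>pos v\<close>, the edge \<open>e\<close> as the simple path \<open>arc_of e\<close> (a simple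
  closed path for a self-loop).
\<close>

definition embedded_on_annulus ::
  "('v, 'e) network \<Rightarrow> ('v \<Rightarrow> complex) \<Rightarrow> ('e \<Rightarrow> real \<Rightarrow> complex) \<Rightarrow> real \<Rightarrow> real \<Rightarrow> bool" where
  "embedded_on_annulus N pos arc_of r R \<longleftrightarrow>
     inj pos \<and> range pos \<subseteq> annulus r R \<and>
     (\<forall>e\<in>edges N.
        simple_path (arc_of e) \<and> path_image (arc_of e) \<subseteq> annulus r R \<and>
        pathstart (arc_of e) = pos (tail N e) \<and> pathfinish (arc_of e) = pos (head N e) \<and>
        arc_of e ` {0<..<1} \<inter> range pos = {}) \<and>
     (\<forall>e\<in>edges N. \<forall>e'\<in>edges N. e \<noteq> e' \<longrightarrow> arc_of e ` {0<..<1} \<inter> arc_of e' ` {0<..<1} = {})"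

definition dart_path :: "('e \<Rightarrow> real \<Rightarrow> complex) \<Rightarrow> 'e dart \<Rightarrow> real \<Rightarrow> complex" where
  "dart_path arc_of d = (if snd d then arc_of (fst d) else reversepath (arc_of (fst d)))"

fun walk_path ::
  "('v, 'e) network \<Rightarrow> ('v \<Rightarrow> complex) \<Rightarrow> ('e \<Rightarrow> real \<Rightarrow> complex) \<Rightarrow> 'v \<Rightarrow> 'e dart list
     \<Rightarrow> real \<Rightarrow> complex" where
  "walk_path N pos arc_of v [] = (\<lambda>t. pos v)"
| "walk_path N pos arc_of v (d # ds) =
     dart_path arc_of d +++ walk_path N pos arc_of (dart_head N d) ds"

definition contractible_in :: "complex set \<Rightarrow> (real \<Rightarrow> complex) \<Rightarrow> bool" where
  "contractible_in A p \<longleftrightarrow> (\<exists>a. homotopic_loops A p (\<lambda>t. a))"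

text \<open>
  Flatness refers to all closed walks, not only to simple cycles: two disjoint non-contractible
  simple cycles joined by a path must have the same monodromy, although such a graph has no
  contractible simple cycle.  The loop \<open>circlepath 0 r\<close>, which runs once counterclockwise along the
  inner boundary, generates the fundamental group of \<open>annulus r R\<close>, and \<open>z\<close> is the monodromy of its
  free homotopy class.
\<close>

definition flat_connection ::
  "('v, 'e) network \<Rightarrow> ('v \<Rightarrow> complex) \<Rightarrow> ('e \<Rightarrow> real \<Rightarrow> complex) \<Rightarrow> real \<Rightarrow> real
     \<Rightarrow> ('e dart \<Rightarrow> complex) \<Rightarrow> complex \<Rightarrow> bool" where
  "flat_connection N pos arc_of r R \<phi> z \<longleftrightarrow>
     connection N \<phi> \<and>
     (\<forall>v ds. walk N v ds v \<and> contractible_in (annulus r R) (walk_path N pos arc_of v ds)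
        \<longrightarrow> monodromy \<phi> ds = 1) \<and>
     (\<forall>v ds. walk N v ds v \<and>
        homotopic_loops (annulus r R) (walk_path N pos arc_of v ds) (circlepath 0 r)
        \<longrightarrow> monodromy \<phi> ds = z)"

definition has_noncontractible_cycle ::
  "('v, 'e) network \<Rightarrow> ('v \<Rightarrow> complex) \<Rightarrow> ('e \<Rightarrow> real \<Rightarrow> complex) \<Rightarrow> real \<Rightarrow> real \<Rightarrow> bool" where
  "has_noncontractible_cycle N pos arc_of r R \<longleftrightarrow>
     (\<exists>v ds. walk N v ds v \<and> \<not> contractible_in (annulus r R) (walk_path N pos arc_of v ds))"

end

theory Submission
  imports Defs
begin

text \<open>
  Lifting the drawing through \<open>exp\<close> to a vertical strip gives every edge an integer gain, and up to gauge
  the Laplacian becomes a matrix \<open>\<Delta>(z)\<close> whose transports are the powers of \<open>z\<close> given by the gains;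
  its transpose is \<open>\<Delta>(1/z)\<close>.  A kernel vector \<open>f\<close> of \<open>\<Delta>(z)\<close> is a harmonic function \<open>(v, n) \<mapsto> z\<^sup>n f v\<close> on
  the infinite cyclic cover.  Let \<open>a\<close> be a vertex at the right boundary of the lifted drawing.  Planarity enters only
  through the fact that disjoint connected sets cannot join interlaced translates of \<open>a\<close>.

  On the unit circle the energy of \<open>f\<close> forces \<open>z = 1\<close>.  For \<open>\<bar>z\<bar> > 1\<close> the harmonic function tends to 0
  at one end of the cover, so by the maximum principle every sign cluster of \<open>Re (\<alpha> z\<^sup>n f v)\<close> reaches
  the other end, and only finitely many clusters do so.  If \<open>z\<close> were not positive, or if \<open>f a = 0\<close>, a
  positive and a negative cluster would both touch infinitely many translates of \<open>a\<close>, against planarity.  Hence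
  \<open>z > 0\<close> and the kernel is a line on which evaluation at \<open>a\<close> does not vanish.

  For a root \<open>x \<noteq> 1\<close> this non-vanishing for \<open>\<Delta>(x)\<close> and \<open>\<Delta>(1/x)\<close> yields an edge on which both
  kernel vectors have non-zero gradient, so the determinant moves to first order with the conductance of that edge.  At
  a multiple root a small change of the conductance of suitable sign would then create a non-real root.  At \<open>z = 1\<close>
  the order is even by reciprocity, and on the unit circle the determinant is at least a constant times
  \<open>\<bar>z - 1\<bar>\<^sup>2\<close>.
\<close>

no_notation fps_nth (infixl "$" 75)

section \<open>Gains and the cyclic cover\<close>

definition dart_gain :: "('e \<Rightarrow> int) \<Rightarrow> 'e dart \<Rightarrow> int" where
  "dart_gain k d = (if snd d then k (fst d) else - k (fst d))"

definition gain :: "('e \<Rightarrow> int) \<Rightarrow> 'e dart list \<Rightarrow> int" where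
  "gain k ds = (\<Sum>d\<leftarrow>ds. dart_gain k d)"

definition rev_walk :: "'e dart list \<Rightarrow> 'e dart list" where
  "rev_walk ds = rev (map rev_dart ds)"

text \<open>Adjacency in the infinite cyclic cover of the network, whose vertices over
  \<open>v\<close> are indexed by integer levels.\<close>

definition cover_adj :: "('v, 'e) network \<Rightarrow> ('e \<Rightarrow> int) \<Rightarrow> (('v \<times> int) \<times> ('v \<times> int)) set" where
  "cover_adj N k =
     {((dart_tail N d, n), (dart_head N d, n + dart_gain k d)) | d n. d \<in> darts N}"

text \<open>Connectedness in the subgraph of the cover induced by \<open>S\<close>. Membership of
  \<open>x\<close> is asked for separately, because the reflexive closure alone would link every
  vertex outside \<open>S\<close> to itself.\<close>

definition linked ::
  "('v, 'e) network \<Rightarrow> ('e \<Rightarrow> int) \<Rightarrow> ('v \<times> int) set \<Rightarrow> 'v \<times> int \<Rightarrow> 'v \<times> int \<Rightarrow> bool" where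
  "linked N k S x y \<longleftrightarrow> x \<in> S \<and> (x, y) \<in> (cover_adj N k \<inter> S \<times> S)\<^sup>*"

section \<open>Reversal, gains of walks, and links in the cover\<close>

lemma rev_dart_simps [simp]:
  "rev_dart (rev_dart d) = d" "rev_dart d \<in> darts N \<longleftrightarrow> d \<in> darts N"
  "dart_tail N (rev_dart d) = dart_head N d" "dart_head N (rev_dart d) = dart_tail N d"
  "fst (rev_dart d) = fst d" "dart_gain k (rev_dart d) = - dart_gain k d"
  by (auto simp: rev_dart_def darts_def dart_tail_def dart_head_def dart_gain_def mem_Times_iff)

lemma finite_darts: "finite (edges N) \<Longrightarrow> finite (darts N)"
  by (simp add: darts_def)

lemma gain_simps [simp]:
  "gain k [] = 0" "gain k (d # ds) = dart_gain k d + gain k ds"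
  "gain k (ds @ es) = gain k ds + gain k es"
  by (auto simp: gain_def)

lemma rev_walk_simps [simp]:
  "rev_walk [] = []" "rev_walk (d # ds) = rev_walk ds @ [rev_dart d]"
  by (auto simp: rev_walk_def)

lemma gain_rev_walk [simp]: "gain k (rev_walk ds) = - gain k ds"
  by (induction ds) auto

lemma walk_append: "walk N u (ds @ es) w \<longleftrightarrow> (\<exists>v. walk N u ds v \<and> walk N v es w)"
  by (induction ds arbitrary: u) auto

lemma walk_rev: "walk N u ds v \<Longrightarrow> walk N v (rev_walk ds) u"
  by (induction ds arbitrary: u) (auto simp: walk_append)

lemma cover_adjI:
  "d \<in> darts N \<Longrightarrow> ((dart_tail N d, n), (dart_head N d, n + dart_gain k d)) \<in> cover_adj N k"
  unfolding cover_adj_def by blast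

lemma cover_adj_sym: "(x, y) \<in> cover_adj N k \<Longrightarrow> (y, x) \<in> cover_adj N k"
proof -
  assume "(x, y) \<in> cover_adj N k"
  then obtain d n where "d \<in> darts N" "x = (dart_tail N d, n)" "y = (dart_head N d, n + dart_gain k d)"
    by (auto simp: cover_adj_def)
  then show ?thesis
    using cover_adjI[of "rev_dart d" N "n + dart_gain k d" k] by simp
qed

lemma linked_refl: "x \<in> S \<Longrightarrow> linked N k S x x"
  by (simp add: linked_def)

lemma linked_in: "linked N k S x y \<Longrightarrow> x \<in> S \<and> y \<in> S"
  unfolding linked_def by (auto elim: rtranclE)

lemma linked_trans: "linked N k S x y \<Longrightarrow> linked N k S y w \<Longrightarrow> linked N k S x w"
  unfolding linked_def by auto

lemma linked_step: "(x, y) \<in> cover_adj N k \<Longrightarrow> x \<in> S \<Longrightarrow> y \<in> S \<Longrightarrow> linked N k S x y"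
  unfolding linked_def by auto

lemma linked_sym: "linked N k S x y \<Longrightarrow> linked N k S y x"
proof -
  assume l: "linked N k S x y"
  have "sym (cover_adj N k \<inter> S \<times> S)"
    by (auto intro!: symI dest: cover_adj_sym)
  then have "sym ((cover_adj N k \<inter> S \<times> S)\<^sup>*)" by (rule sym_rtrancl)
  with l linked_in[OF l] show ?thesis unfolding linked_def by (meson symD)
qed

lemma linked_mono: "linked N k S x y \<Longrightarrow> S \<subseteq> T \<Longrightarrow> linked N k T x y"
  unfolding linked_def using rtrancl_mono[of "cover_adj N k \<inter> S \<times> S" "cover_adj N k \<inter> T \<times> T"]
  by blast

lemma linked_induct [consumes 1, case_names refl step]:
  assumes "linked N k S x y" and "x \<in> S \<Longrightarrow> Q x"
    and "\<And>d n. linked N k S x (dart_tail N d, n) \<Longrightarrow> d \<in> darts N \<Longrightarrow>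
           (dart_head N d, n + dart_gain k d) \<in> S \<Longrightarrow> Q (dart_tail N d, n) \<Longrightarrow>
           Q (dart_head N d, n + dart_gain k d)"
  shows "Q y"
proof -
  have "x \<in> S" "(x, y) \<in> (cover_adj N k \<inter> S \<times> S)\<^sup>*" using assms(1) by (auto simp: linked_def)
  from this(2) show ?thesis
  proof (induction rule: rtrancl_induct)
    case base
    then show ?case using assms(2) \<open>x \<in> S\<close> by blast
  next
    case (step y w)
    then have "linked N k S x y" using \<open>x \<in> S\<close> by (simp add: linked_def)
    moreover obtain d n where "d \<in> darts N" "y = (dart_tail N d, n)"
      "w = (dart_head N d, n + dart_gain k d)"
      using step by (auto simp: cover_adj_def)
    ultimately show ?case using assms(3) step by blast
  qed
qed

text \<open>Gains do not depend on the level, so the deck translation by \<open>j\<close> is an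
  automorphism of the cover.\<close>

lemma linked_shift:
  "linked N k S x y \<Longrightarrow> linked N k {w. (fst w, snd w - j) \<in> S} (fst x, snd x + j) (fst y, snd y + j)"
proof (induction rule: linked_induct)
  case refl
  then show ?case by (intro linked_refl) auto
next
  case (step d n)
  have "linked N k {w. (fst w, snd w - j) \<in> S} (dart_tail N d, n + j) (dart_head N d, n + j + dart_gain k d)"
    using step linked_in[OF step(1)] by (intro linked_step cover_adjI) (auto simp: algebra_simps)
  then show ?case using step(4) linked_trans by (fastforce simp: algebra_simps)
qed

lemma linked_shift_UNIV:
  "linked N k UNIV (u, n) (v, m) \<Longrightarrow> linked N k UNIV (u, n + j) (v, m + j)"
  using linked_shift[of N k UNIV "(u, n)" "(v, m)" j] by simp

text \<open>Negating all gains reflects the cover in level 0. This symmetry later exchanges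
  \<open>z\<close> with \<open>1 / z\<close>.\<close>

lemma linked_uminus:
  "linked N (\<lambda>e. - k e) S x y \<Longrightarrow>
     linked N k {w. (fst w, - snd w) \<in> S} (fst x, - snd x) (fst y, - snd y)"
proof (induction rule: linked_induct)
  case refl
  then show ?case by (intro linked_refl) auto
next
  case (step d n)
  have *: "dart_gain (\<lambda>e. - k e) d = - dart_gain k d" by (simp add: dart_gain_def)
  have "linked N k {w. (fst w, - snd w) \<in> S} (dart_tail N d, - n) (dart_head N d, - n + dart_gain k d)"
    using step(2,3) linked_in[OF step(1)] * by (intro linked_step cover_adjI) auto
  then show ?case using step(4) linked_trans * by fastforce
qed

lemma walk_linked:
  "walk N u ds v \<Longrightarrow> linked N k UNIV (u, n) (v, n + gain k ds)"
proof (induction ds arbitrary: u n)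
  case Nil
  then show ?case by (simp add: linked_refl)
next
  case (Cons d ds)
  then have "linked N k UNIV (u, n) (dart_head N d, n + dart_gain k d)"
    by (intro linked_step) (auto intro: cover_adjI)
  moreover have "linked N k UNIV (dart_head N d, n + dart_gain k d) (v, n + dart_gain k d + gain k ds)"
    using Cons by auto
  ultimately show ?case using linked_trans by (fastforce simp: add.assoc)
qed

lemma linked_walk:
  assumes "linked N k UNIV (u, n) (v, m)"
  shows "\<exists>ds. walk N u ds v \<and> gain k ds = m - n"
  using assms
proof (induction "(v, m)" arbitrary: v m rule: linked_induct)
  case refl
  then show ?case by (intro exI[of _ "[]"]) auto
next
  case (step d j)
  then obtain ds where "walk N u ds (dart_tail N d)" "gain k ds = j - n" by blast
  then show ?case using step by (intro exI[of _ "ds @ [d]"]) (auto simp: walk_append)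
qed

section \<open>Harmonic functions on the cover of an annular network\<close>

text \<open>Conductances are kept apart from the graph so that a single one can be varied
  later.\<close>

definition positive_on_edges :: "('v, 'e) network \<Rightarrow> ('e \<Rightarrow> real) \<Rightarrow> bool" where
  "positive_on_edges N c \<longleftrightarrow> (\<forall>e\<in>edges N. 0 < c e)"

definition harmonic ::
  "('v, 'e) network \<Rightarrow> ('e \<Rightarrow> int) \<Rightarrow> ('e \<Rightarrow> real) \<Rightarrow> ('v \<times> int \<Rightarrow> real) \<Rightarrow> bool" where
  "harmonic N k c h \<longleftrightarrow>
     (\<forall>u n. (\<Sum>d | d \<in> darts N \<and> dart_tail N d = u.
        c (fst d) * (h (u, n) - h (dart_head N d, n + dart_gain k d))) = 0)"

text \<open>
  The crossing axiom is what remains of planarity: \<open>a\<close> lies on the boundary of the drawing in the strip, so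
  connected sets joining interlaced translates of \<open>a\<close> must meet.
\<close>

locale annular_network =
  fixes N :: "('v::finite, 'e) network" and k :: "'e \<Rightarrow> int" and a :: 'v
  assumes fin: "finite (edges N)"
    and conn: "\<And>u v. \<exists>ds. walk N u ds v"
    and noncontractible: "\<exists>v ds. walk N v ds v \<and> gain k ds \<noteq> 0"
    and crossing: "\<And>S T n\<^sub>1 n\<^sub>2 n\<^sub>3 n\<^sub>4. linked N k S (a, n\<^sub>1) (a, n\<^sub>3) \<Longrightarrow> linked N k T (a, n\<^sub>2) (a, n\<^sub>4) \<Longrightarrow>
      n\<^sub>1 < n\<^sub>2 \<Longrightarrow> n\<^sub>2 < n\<^sub>3 \<Longrightarrow> n\<^sub>3 < n\<^sub>4 \<Longrightarrow> S \<inter> T \<noteq> {}"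
begin

lemma cover_linked_base: "\<exists>m. linked N k UNIV (a, n) (v, m)"
  using conn walk_linked by meson

text \<open>Some closed walk at \<open>a\<close> has positive gain \<open>g\<close>. If
  \<open>g > 1\<close>, its lifts from levels 0 and 1 end at levels \<open>g\<close> and
  \<open>g + 1\<close> and are therefore interlaced, so planarity puts \<open>(a, 0)\<close> and
  \<open>(a, 1)\<close> into one component.\<close>

lemma gain_one: "linked N k UNIV (a, 0) (a, 1)"
proof -
  obtain v ds es where *: "walk N v ds v" "gain k ds \<noteq> 0" "walk N a es v"
    using noncontractible conn by meson
  define ws where "ws = es @ ds @ rev_walk es"
  have ws: "walk N a ws a" "gain k ws \<noteq> 0"
    using * walk_rev[OF *(3)] by (auto simp: ws_def walk_append)
  obtain ws' where ws': "walk N a ws' a" "gain k ws' > 0"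
  proof (cases "gain k ws > 0")
    case True
    then show ?thesis using ws that by blast
  next
    case False
    then show ?thesis using ws that[of "rev_walk ws"] walk_rev[of N a ws a] by auto
  qed
  \<comment> \<open>Links are confined to the component of their starting point, so that the
    crossing axiom yields a common point of two components.\<close>
  define S where "S = (\<lambda>j. {x. linked N k UNIV (a, j) x})"
  have l: "linked N k (S j) (a, j) (a, j + gain k ws')" for j
  proof -
    have "linked N k UNIV (a, j) x \<Longrightarrow> linked N k (S j) (a, j) x" for x
    proof (induction rule: linked_induct)
      case refl
      then show ?case by (auto simp: S_def linked_refl)
    next
      case (step d n)
      have "linked N k UNIV (a, j) (dart_head N d, n + dart_gain k d)"
        using step by (meson UNIV_I cover_adjI linked_step linked_trans)
      then have "linked N k (S j) (dart_tail N d, n) (dart_head N d, n + dart_gain k d)"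
        using step by (intro linked_step cover_adjI) (auto simp: S_def)
      then show ?case using step linked_trans by fast
    qed
    then show ?thesis using walk_linked[OF ws'(1)] by blast
  qed
  show ?thesis
  proof (cases "gain k ws' = 1")
    case True
    then show ?thesis using walk_linked[OF ws'(1), of k 0] by simp
  next
    case False
    then have "S 0 \<inter> S 1 \<noteq> {}"
      using crossing[OF l[of 0] l[of 1]] ws'(2) by auto
    then obtain x where "linked N k UNIV (a, 0) x" "linked N k UNIV (a, 1) x"
      by (auto simp: S_def)
    then show ?thesis using linked_sym linked_trans by metis
  qed
qed

text \<open>Translates of the link from \<open>gain_one\<close> join all lifts of \<open>a\<close>,
  and connectedness of the network joins every vertex of the cover to one of these.\<close>

lemma cover_connected: "linked N k UNIV x y"
proof -
  have 1: "linked N k UNIV (a, n) (a, n + int j)" for n j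
  proof (induction j)
    case 0
    then show ?case by (simp add: linked_refl)
  next
    case (Suc j)
    have "linked N k UNIV (a, n + int j) (a, n + int j + 1)"
      using linked_shift_UNIV[OF gain_one, of "n + int j"] by (simp add: algebra_simps)
    then show ?case using Suc linked_trans by (fastforce simp: algebra_simps)
  qed
  have 2: "linked N k UNIV (a, n) (a, m)" for n m
  proof (cases "n \<le> m")
    case True
    then show ?thesis using 1[of n "nat (m - n)"] by simp
  next
    case False
    then show ?thesis using linked_sym[OF 1[of m "nat (n - m)"]] by simp
  qed
  have "\<exists>n. linked N k UNIV (a, n) z" for z
  proof -
    obtain m where "linked N k UNIV (a, 0) (fst z, m)" using cover_linked_base by blast
    from linked_shift_UNIV[OF this, of "snd z - m"] show ?thesis by auto
  qed
  then show ?thesis using 2 linked_sym linked_trans by metis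
qed

lemma closed_walk_gain_one: "\<exists>ds. walk N v ds v \<and> gain k ds = 1"
  using linked_walk[OF cover_connected[of "(v, 0)" "(v, 1)"]] by simp

end

text \<open>Reflection reverses the order of the four levels; the axiom is then applied with the two
  sets exchanged.\<close>

lemma (in annular_network) mirrored: "annular_network N (\<lambda>e. - k e) a"
proof
  have g: "gain (\<lambda>e. - k e) ds = - gain k ds" for ds
    by (induction ds) (auto simp: dart_gain_def)
  show "finite (edges N)" "\<And>u v. \<exists>ds. walk N u ds v" by (fact fin conn)+
  show "\<exists>v ds. walk N v ds v \<and> gain (\<lambda>e. - k e) ds \<noteq> 0"
    using noncontractible g by auto
  fix S T n\<^sub>1 n\<^sub>2 n\<^sub>3 n\<^sub>4
  assume *: "linked N (\<lambda>e. - k e) S (a, n\<^sub>1) (a, n\<^sub>3)" "linked N (\<lambda>e. - k e) T (a, n\<^sub>2) (a, n\<^sub>4)"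
    "n\<^sub>1 < n\<^sub>2" "n\<^sub>2 < n\<^sub>3" "n\<^sub>3 < n\<^sub>4"
  have "linked N k {w. (fst w, - snd w) \<in> T} (a, - n\<^sub>4) (a, - n\<^sub>2)"
    using linked_sym[OF linked_uminus[OF *(2)]] by simp
  moreover have "linked N k {w. (fst w, - snd w) \<in> S} (a, - n\<^sub>3) (a, - n\<^sub>1)"
    using linked_sym[OF linked_uminus[OF *(1)]] by simp
  ultimately have "{w. (fst w, - snd w) \<in> T} \<inter> {w. (fst w, - snd w) \<in> S} \<noteq> {}"
    by (rule crossing) (use * in auto)
  then show "S \<inter> T \<noteq> {}" by auto
qed

text \<open>
  If the cluster were bounded above, \<open>h\<close> would attain its maximum over the cluster; the value would then
  propagate to all neighbours, and the cluster would be the whole cover.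
\<close>

lemma (in annular_network) positive_cluster_unbounded:
  assumes c: "positive_on_edges N c" and h: "harmonic N k c h"
    and decay: "\<And>\<epsilon>. \<epsilon> > 0 \<Longrightarrow> \<exists>m. \<forall>u n. n < m \<longrightarrow> h (u, n) < \<epsilon>"
    and x: "h x > 0"
  shows "\<exists>y. linked N k {w. h w > 0} x y \<and> L \<le> snd y"
proof (rule ccontr)
  assume "\<not> ?thesis"
  then have below: "snd y < L" if "linked N k {w. h w > 0} x y" for y
    using that by (metis not_le)
  define C where "C = {y. linked N k {w. h w > 0} x y}"
  \<comment> \<open>Levels in this part of the cluster are bounded below by the decay and above by
    the assumption, so it is finite and carries the maximum over the whole cluster.\<close>
  define C' where "C' = {y \<in> C. h x \<le> h y}"
  obtain m where m: "\<And>u n. n < m \<Longrightarrow> h (u, n) < h x" using decay[OF x] by blast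
  have "C' \<subseteq> UNIV \<times> {m..L}"
    using m below by (force simp: C'_def C_def not_less[symmetric])
  then have "finite C'" by (rule finite_subset) auto
  moreover have "x \<in> C'" using x by (auto simp: C'_def C_def linked_refl)
  ultimately have fin': "finite (h ` C')" and "h ` C' \<noteq> {}" by auto
  then have "Max (h ` C') \<in> h ` C'" by (rule Max_in)
  then obtain y where y1: "y \<in> C'" and hy: "Max (h ` C') = h y" by blast
  have y2: "h w \<le> h y" if "w \<in> C'" for w
    unfolding hy[symmetric] using fin' that by (intro Max_ge) auto
  have y_max: "h w \<le> h y" if "w \<in> C" for w
  proof (cases "h x \<le> h w")
    case True
    then have "w \<in> C'" using that by (simp add: C'_def)
    then show ?thesis by (rule y2)
  next
    case False
    moreover have "h x \<le> h y" using y1 by (simp add: C'_def)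
    ultimately show ?thesis by linarith
  qed
  have y_pos: "h y > 0" using y1 x by (simp add: C'_def)
  have "w \<in> C \<and> h w = h y" if "linked N k UNIV y w" for w
    using that
  proof (induction rule: linked_induct)
    case refl
    then show ?case using y1 by (simp add: C'_def)
  next
    case (step d n)
    define D where "D = {d' \<in> darts N. dart_tail N d' = dart_tail N d}"
    \<comment> \<open>A neighbour outside the cluster has a non-positive value, hence also lies
      below the positive maximum.\<close>
    have le: "h (dart_head N d', n + dart_gain k d') \<le> h y" if "d' \<in> D" for d'
    proof (cases "h (dart_head N d', n + dart_gain k d') > 0")
      case True
      then have "linked N k {w. h w > 0} (dart_tail N d, n) (dart_head N d', n + dart_gain k d')"
        using that step(4) y_pos cover_adjI[of d' N n k] by (intro linked_step) (auto simp: D_def)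
      moreover have "linked N k {w. h w > 0} x (dart_tail N d, n)"
        using step(4) by (simp add: C_def)
      ultimately have "(dart_head N d', n + dart_gain k d') \<in> C"
        unfolding C_def mem_Collect_eq by (rule linked_trans[rotated])
      then show ?thesis by (rule y_max)
    qed (use y_pos in simp)
    define \<Delta> where "\<Delta> d' = c (fst d') * (h (dart_tail N d, n) - h (dart_head N d', n + dart_gain k d'))"
      for d'
    have c_pos: "c (fst d') > 0" if "d' \<in> D" for d'
      using that c by (auto simp: positive_on_edges_def D_def darts_def)
    have "sum \<Delta> D = 0"
      using h by (auto simp: harmonic_def D_def \<Delta>_def)
    moreover have "\<Delta> d' \<ge> 0" if "d' \<in> D" for d'
      using c_pos[OF that] le[OF that] step(4) by (simp add: less_imp_le \<Delta>_def)
    moreover have "finite D" using finite_darts[OF fin] by (auto simp: D_def)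
    moreover have "d \<in> D" using step(2) by (simp add: D_def)
    ultimately have "\<Delta> d = 0"
      using sum_nonneg_eq_0_iff[of D \<Delta>] by simp
    then have eq: "h (dart_head N d, n + dart_gain k d) = h y"
      using c_pos[OF \<open>d \<in> D\<close>] step(4) by (simp add: \<Delta>_def)
    then have "linked N k {w. h w > 0} (dart_tail N d, n) (dart_head N d, n + dart_gain k d)"
      using step(2,4) y_pos cover_adjI[of d N n k] by (intro linked_step) auto
    moreover have "linked N k {w. h w > 0} x (dart_tail N d, n)"
      using step(4) by (simp add: C_def)
    ultimately have "(dart_head N d, n + dart_gain k d) \<in> C"
      unfolding C_def mem_Collect_eq by (rule linked_trans[rotated])
    then show ?case using eq by simp
  qed
  then have "(a, L) \<in> C" using cover_connected by blast
  then show False using below by (force simp: C_def)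
qed

text \<open>One step changes the level by at most \<open>B\<close>, so a path cannot jump over the
  window when it first reaches a non-negative level.\<close>

lemma (in annular_network) linked_window:
  obtains B :: int where "0 \<le> B"
    "\<And>S x y. linked N k S x y \<Longrightarrow> snd x < 0 \<Longrightarrow> 0 \<le> snd y \<Longrightarrow>
       \<exists>w\<in>UNIV \<times> {0..B}. linked N k S x w"
proof -
  define B where "B = (\<Sum>d\<in>darts N. \<bar>dart_gain k d\<bar>)"
  have B: "\<bar>dart_gain k d\<bar> \<le> B" if "d \<in> darts N" for d
    unfolding B_def using that finite_darts[OF fin]
    by (intro member_le_sum) auto
  have "\<exists>w\<in>UNIV \<times> {0..B}. linked N k S x w"
    if "linked N k S x y" "snd x < 0" "0 \<le> snd y" for S x y
    using that
  proof (induction rule: linked_induct)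
    case refl
    then show ?case by simp
  next
    case (step d n)
    show ?case
    proof (cases "0 \<le> n")
      case True
      then show ?thesis using step by simp
    next
      case False
      have "linked N k S (dart_tail N d, n) (dart_head N d, n + dart_gain k d)"
        using step linked_in[OF step(1)] by (intro linked_step cover_adjI) auto
      then have "linked N k S x (dart_head N d, n + dart_gain k d)"
        using step linked_trans by fast
      moreover have "n + dart_gain k d \<le> B" using False B[OF step(2)] by auto
      ultimately show ?thesis using step by force
    qed
  qed
  moreover have "0 \<le> B" by (auto simp: B_def intro: sum_nonneg)
  ultimately show ?thesis using that by blast
qed

text \<open>
  The nearby zeros let a sign cluster be reached from a vertex at which \<open>h\<close> vanishes, while tubes around distant
  levels of opposite sign stay disjoint.
\<close>

definition tube :: "('v \<times> int \<Rightarrow> real) \<Rightarrow> int \<Rightarrow> int \<Rightarrow> ('v \<times> int) set" where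
  "tube h J n = {y. h y > 0 \<or> h y = 0 \<and> \<bar>snd y - n\<bar> \<le> J}"

text \<open>
  By the maximum principle all these tubes pass through a finite window of levels.  Hence one positive and one negative
  cluster each touch infinitely many translates of \<open>a\<close>, and these can be chosen interlaced.
\<close>

lemma (in annular_network) no_alternating_clusters:
  assumes c: "positive_on_edges N c" and h: "harmonic N k c h"
    and decay: "\<And>\<epsilon>. \<epsilon> > 0 \<Longrightarrow> \<exists>m. \<forall>u n. n < m \<longrightarrow> \<bar>h (u, n)\<bar> < \<epsilon>"
    and pos: "\<And>b. \<exists>n<b. \<exists>x. h x > 0 \<and> linked N k (tube h J n) (a, n) x"
    and neg: "\<And>b. \<exists>n<b. \<exists>x. h x < 0 \<and> linked N k (tube (\<lambda>y. - h y) J n) (a, n) x"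
  shows False
proof -
  obtain B where "0 \<le> B" and B:
    "\<And>S x y. linked N k S x y \<Longrightarrow> snd x < 0 \<Longrightarrow> 0 \<le> snd y \<Longrightarrow>
       \<exists>w\<in>UNIV \<times> {0..B}. linked N k S x w"
    using linked_window by blast
  define W where "W = (UNIV :: 'v set) \<times> {0..B}"
  have "finite W" "W \<noteq> {}" using \<open>0 \<le> B\<close> by (auto simp: W_def)
  \<comment> \<open>Pigeonhole over the window: if each of its finitely many points were reached
    only from levels above some bound, take a translate of \<open>a\<close> below all bounds. Its
    tube contains a cluster climbing to level 0, which must pass through the window.\<close>
  have key: "\<exists>w. \<forall>b. \<exists>n<b. linked N k (tube g J n) (a, n) w"
    if g: "harmonic N k c g" "\<And>\<epsilon>. \<epsilon> > 0 \<Longrightarrow> \<exists>m. \<forall>u n. n < m \<longrightarrow> \<bar>g (u, n)\<bar> < \<epsilon>"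
      and inf: "\<And>b. \<exists>n<b. \<exists>x. g x > 0 \<and> linked N k (tube g J n) (a, n) x" for g
  proof (rule ccontr)
    assume "\<not> ?thesis"
    then have "\<forall>w. \<exists>b. \<forall>n<b. \<not> linked N k (tube g J n) (a, n) w" by blast
    then obtain b where b: "\<And>w n. n < b w \<Longrightarrow> \<not> linked N k (tube g J n) (a, n) w" by metis
    define b' where "b' = min 0 (Min (b ` W))"
    have b': "b' \<le> b w" if "w \<in> W" for w
      unfolding b'_def using that \<open>finite W\<close> by (simp add: min.coboundedI2)
    obtain n x where nx: "n < b'" "g x > 0" "linked N k (tube g J n) (a, n) x" using inf by blast
    have "\<exists>m. \<forall>u n. n < m \<longrightarrow> g (u, n) < \<epsilon>" if "\<epsilon> > 0" for \<epsilon>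
      using g(2)[OF that] by (metis abs_less_iff)
    then obtain y where y: "linked N k {w. g w > 0} x y" "0 \<le> snd y"
      using positive_cluster_unbounded[OF c g(1) _ nx(2)] by blast
    have "linked N k (tube g J n) (a, n) y"
      using nx linked_mono[OF y(1), of "tube g J n"] linked_trans by (fastforce simp: tube_def)
    then obtain w where "w \<in> W" "linked N k (tube g J n) (a, n) w"
      using B[of "tube g J n" "(a, n)" y] y nx by (auto simp: b'_def W_def)
    then show False using b[of n w] b'[of w] nx by linarith
  qed
  obtain p where p: "\<And>b. \<exists>n<b. linked N k (tube h J n) (a, n) p"
    using key[OF h decay pos] by blast
  have h': "harmonic N k c (\<lambda>y. - h y)"
  proof -
    have "(\<Sum>d | d \<in> darts N \<and> dart_tail N d = u.
            c (fst d) * (- h (u, n) - - h (dart_head N d, n + dart_gain k d))) =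
          - (\<Sum>d | d \<in> darts N \<and> dart_tail N d = u.
            c (fst d) * (h (u, n) - h (dart_head N d, n + dart_gain k d)))" for u n
      by (simp add: sum_negf[symmetric] algebra_simps)
    then show ?thesis using h by (simp add: harmonic_def)
  qed
  obtain q where q: "\<And>b. \<exists>n<b. linked N k (tube (\<lambda>y. - h y) J n) (a, n) q"
    using key[OF h'] decay neg by auto
  \<comment> \<open>Gaps of more than \<open>2 * J'\<close> separate the zero layers of the positive
    tubes from those of the negative ones; elsewhere the signs separate them. The maximum with 0
    keeps the four levels strictly ordered.\<close>
  define J' where "J' = max 0 J"
  obtain n4 where n4: "linked N k (tube (\<lambda>y. - h y) J n4) (a, n4) q" using q by blast
  obtain n3 where n3: "n3 < n4 - 2 * J'" "linked N k (tube h J n3) (a, n3) p" using p by blast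
  obtain n2 where n2: "n2 < n3 - 2 * J'" "linked N k (tube (\<lambda>y. - h y) J n2) (a, n2) q" using q by blast
  obtain n1 where n1: "n1 < n2 - 2 * J'" "linked N k (tube h J n1) (a, n1) p" using p by blast
  define S where "S = tube h J n1 \<union> tube h J n3"
  define T where "T = tube (\<lambda>y. - h y) J n2 \<union> tube (\<lambda>y. - h y) J n4"
  have S: "linked N k S (a, n1) (a, n3)"
    using linked_mono[OF n1(2), of S] linked_sym[OF linked_mono[OF n3(2), of S]] linked_trans
    by (fastforce simp: S_def)
  have T: "linked N k T (a, n2) (a, n4)"
    using linked_mono[OF n2(2), of T] linked_sym[OF linked_mono[OF n4, of T]] linked_trans
    by (fastforce simp: T_def)
  have "n1 < n2" "n2 < n3" "n3 < n4" "0 \<le> J'" "J \<le> J'" using n1 n2 n3 by (auto simp: J'_def)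
  then obtain y where "y \<in> S" "y \<in> T" using crossing[OF S T] by blast
  then show False
    using n1(1) n2(1) n3(1) \<open>0 \<le> J'\<close> \<open>J \<le> J'\<close> by (auto simp: S_def T_def tube_def)
qed

section \<open>Signs of powers\<close>

text \<open>By compactness two powers whose exponents differ by at least \<open>M\<close> come close
  together, and their quotient is a power close to 1.\<close>

lemma unimodular_power_recurrent:
  fixes w :: complex
  assumes w: "cmod w = 1" and "\<epsilon> > 0"
  shows "\<exists>p\<ge>M. cmod (w ^ p - 1) < \<epsilon>"
proof -
  have "compact (sphere (0::complex) 1)" "\<forall>i. w ^ i \<in> sphere 0 1"
    using w by (auto simp: norm_power)
  then obtain l r where r: "strict_mono (r :: nat \<Rightarrow> nat)" "((\<lambda>i. w ^ i) \<circ> r) \<longlonglongrightarrow> l"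
    using seq_compactE[of "sphere (0::complex) 1" "\<lambda>i. w ^ i"] compact_imp_seq_compact by metis
  then have "Cauchy ((\<lambda>i. w ^ i) \<circ> r)" by (rule_tac LIMSEQ_imp_Cauchy)
  then obtain K where K: "\<And>m n. m \<ge> K \<Longrightarrow> n \<ge> K \<Longrightarrow> dist (w ^ r m) (w ^ r n) < \<epsilon>"
    using \<open>\<epsilon> > 0\<close> unfolding Cauchy_def o_def by blast
  define p where "p = r (K + M) - r K"
  have r_add: "r K + i \<le> r (K + i)" for i
  proof (induction i)
    case (Suc i)
    then show ?case using strict_monoD[OF r(1), of "K + i" "Suc (K + i)"] by simp
  qed simp
  have p: "r (K + M) = r K + p" "M \<le> p"
    using r_add[of M] unfolding p_def by linarith+
  have "w ^ r (K + M) - w ^ r K = w ^ r K * (w ^ p - 1)"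
    by (simp add: p power_add algebra_simps)
  then have "cmod (w ^ p - 1) = dist (w ^ r (K + M)) (w ^ r K)"
    using w by (simp add: dist_norm norm_mult norm_power)
  then show ?thesis using K[of "K + M" K] p(2) by auto
qed

text \<open>For unimodular \<open>u\<close> the defect \<open>1 - Re u\<close> becomes
  \<open>2 * (1 - Re u) * (1 + Re u)\<close> under squaring. It would at least double with each
  squaring if all real parts were non-negative, yet it would stay at most 1.\<close>

lemma unimodular_power_Re_neg:
  fixes w :: complex
  assumes w: "cmod w = 1" "w \<noteq> 1"
  shows "\<exists>j. Re (w ^ j) < 0"
proof (rule ccontr)
  assume "\<not> ?thesis"
  then have nn: "Re (w ^ j) \<ge> 0" for j by (meson not_le)
  define y where "y = (\<lambda>i. 1 - Re (w ^ (2 ^ i)))"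
  have "y (Suc i) \<ge> 2 * y i" for i
  proof -
    define u where "u = w ^ (2 ^ i)"
    have "(Re u)\<^sup>2 + (Im u)\<^sup>2 = 1"
      using w cmod_power2[of u] by (simp add: u_def norm_power)
    then have "1 - Re (u\<^sup>2) = 2 * (1 - Re u) + 2 * (Re u * (1 - Re u))"
      by (simp add: power2_eq_square algebra_simps)
    moreover have "0 \<le> Re u" "Re u \<le> 1"
      using nn complex_Re_le_cmod[of u] w by (auto simp: u_def norm_power)
    then have "0 \<le> Re u * (1 - Re u)" by simp
    moreover have "w ^ 2 ^ Suc i = u\<^sup>2" by (simp add: u_def power_mult[symmetric] mult.commute)
    ultimately show ?thesis by (simp add: y_def u_def)
  qed
  then have y: "y i \<ge> 2 ^ i * y 0" for i
  proof (induction i)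
    case (Suc i)
    then have "2 * (2 ^ i * y 0) \<le> 2 * y i" "2 * y i \<le> y (Suc i)" by simp_all
    then show ?case by simp
  qed simp
  have "Re w < 1"
  proof (rule ccontr)
    assume "\<not> Re w < 1"
    then have "Re w = 1" using complex_Re_le_cmod[of w] w by simp
    then have "Im w = 0" using cmod_power2[of w] w by simp
    then show False using \<open>Re w = 1\<close> w by (simp add: complex_eq_iff)
  qed
  then have "y 0 > 0" by (simp add: y_def)
  obtain i where "1 / y 0 < 2 ^ i" using real_arch_pow[of 2 "1 / y 0"] by auto
  then have "1 < 2 ^ i * y 0" using \<open>y 0 > 0\<close> by (simp add: field_simps)
  moreover have "y i \<le> 1" using nn by (simp add: y_def)
  ultimately show False using y[of i] by simp
qed

text \<open>Only the phase \<open>w\<close> of \<open>z\<close> matters for the sign. Powers of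
  \<open>w\<close> return close to 1 at arbitrarily large exponents, and a sign attained at one
  exponent \<open>j\<close> recurs along with them.\<close>

lemma Re_power_int_signs:
  fixes z :: complex
  assumes "z \<noteq> 0"
  shows "\<exists>n<b. Re (z powi n) > 0" and "z \<noteq> of_real (cmod z) \<Longrightarrow> \<exists>n<b. Re (z powi n) < 0"
proof -
  define w where "w = z / of_real (cmod z)"
  have w: "cmod w = 1" using assms by (simp add: w_def norm_divide)
  have z: "z = of_real (cmod z) * w" using assms by (simp add: w_def)
  \<comment> \<open>Negative exponents conjugate the phase, which leaves the real part
    unchanged.\<close>
  have *: "Re (z powi (- int n)) = cmod z powi (- int n) * Re (w ^ n)" for n
  proof -
    have "cnj w = inverse w"
      using w complex_norm_square[of w] by (intro inverse_unique[symmetric]) auto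
    then have "w powi (- int n) = cnj (w ^ n)"
      by (simp add: power_int_minus power_inverse)
    then have "z powi (- int n) = of_real (cmod z powi (- int n)) * cnj (w ^ n)"
      by (subst z) (simp add: power_int_mult_distrib)
    then show ?thesis by (simp del: of_real_power_int complex_cnj_power)
  qed
  have p: "cmod z powi n > 0" for n using assms by (simp add: zero_less_power_int)
  obtain n where n: "n \<ge> nat (1 - b)" "cmod (w ^ n - 1) < 1"
    using unimodular_power_recurrent[OF w, of 1] by auto
  then have "Re (w ^ n) > 0" using abs_Re_le_cmod[of "w ^ n - 1"] by auto
  then show "\<exists>n<b. Re (z powi n) > 0"
    using n p * by (intro exI[of _ "- int n"]) auto
  assume "z \<noteq> of_real (cmod z)"
  then have "w \<noteq> 1" using z by auto
  then obtain j where j: "Re (w ^ j) < 0" using unimodular_power_Re_neg w by blast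
  obtain n where n: "n \<ge> nat (1 - b)" "cmod (w ^ n - 1) < - Re (w ^ j)"
    using unimodular_power_recurrent[OF w, of "- Re (w ^ j)"] j by auto
  have "w ^ (n + j) = w ^ j + w ^ j * (w ^ n - 1)" by (simp add: power_add algebra_simps)
  moreover have "\<bar>Re (w ^ j * (w ^ n - 1))\<bar> \<le> cmod (w ^ n - 1)"
    using abs_Re_le_cmod[of "w ^ j * (w ^ n - 1)"] w by (simp add: norm_mult norm_power)
  ultimately have "Re (w ^ (n + j)) < 0" using n(2) by simp
  then have "Re (z powi (- int (n + j))) < 0" using p[of "- int (n + j)"] unfolding * by (simp add: mult_pos_neg)
  then show "\<exists>n<b. Re (z powi n) < 0" using n by (intro exI[of _ "- int (n + j)"]) auto
qed

section \<open>The Laplacian in terms of gains\<close>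

text \<open>The gauge-normalised Laplacian. The factor at the head is \<open>z\<close> to the power
  of the gain, so that a kernel vector \<open>f\<close> extends to the harmonic function
  \<open>z powi n * f $ v\<close> on the cover; in the convention of \<open>laplacian\<close> this
  is the matrix for monodromy \<open>1 / z\<close>.\<close>

definition gain_laplacian ::
  "('v::finite, 'e) network \<Rightarrow> ('e \<Rightarrow> int) \<Rightarrow> ('e \<Rightarrow> real) \<Rightarrow> complex \<Rightarrow> complex ^ 'v ^ 'v" where
  "gain_laplacian N k c z =
     (\<chi> u v. \<Sum>d | d \<in> darts N \<and> dart_tail N d = u.
        of_real (c (fst d)) * ((if u = v then 1 else 0) -
          z powi dart_gain k d * (if dart_head N d = v then 1 else 0)))"

lemma gain_laplacian_mult:
  "(gain_laplacian N k c z *v g) $ u =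
     (\<Sum>d | d \<in> darts N \<and> dart_tail N d = u.
        of_real (c (fst d)) * (g $ u - z powi dart_gain k d * g $ dart_head N d))"
proof -
  have "(\<Sum>v\<in>UNIV. (of_real C * ((if u = v then 1 else 0) - Z * (if w = v then 1 else 0))) * g $ v) =
        of_real C * (g $ u - Z * g $ w)" for C Z w
    by (simp add: algebra_simps sum_subtractf sum_distrib_left[symmetric] if_distrib[of "\<lambda>x. x * _"]
        if_distrib[of "\<lambda>x. _ * x"] cong: if_cong)
  then show ?thesis
    by (simp add: gain_laplacian_def matrix_vector_mult_def sum_distrib_right) (subst sum.swap, simp)
qed

text \<open>Green's identity: the two darts of an edge have inverse transports, so their terms
  combine into a product of two gradients. Symmetry, energy and the rank-one effect of a conductance
  all come from this form.\<close>

lemma gain_laplacian_bilinear: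
  assumes "finite (edges N)" "z \<noteq> 0"
  shows "(\<Sum>u\<in>UNIV. p $ u * (gain_laplacian N k c z *v g) $ u) =
     (\<Sum>e\<in>edges N. of_real (c e) * (p $ tail N e - z powi (- k e) * p $ head N e) *
        (g $ tail N e - z powi k e * g $ head N e))"
proof -
  define F where "F d = of_real (c (fst d)) * p $ dart_tail N d *
    (g $ dart_tail N d - z powi dart_gain k d * g $ dart_head N d)" for d
  have "(\<Sum>u\<in>UNIV. p $ u * (gain_laplacian N k c z *v g) $ u) =
        (\<Sum>u\<in>UNIV. \<Sum>d | d \<in> darts N \<and> dart_tail N d = u. F d)"
    unfolding gain_laplacian_mult sum_distrib_left
    by (intro sum.cong refl) (auto simp: F_def)
  also have "\<dots> = (\<Sum>d\<in>darts N. F d)"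
    by (rule sum.group) (auto simp: finite_darts assms)
  also have "\<dots> = (\<Sum>e\<in>edges N. \<Sum>b\<in>UNIV. F (e, b))"
    by (simp add: darts_def sum.cartesian_product)
  also have "\<dots> = (\<Sum>e\<in>edges N. of_real (c e) * (p $ tail N e - z powi (- k e) * p $ head N e) *
        (g $ tail N e - z powi k e * g $ head N e))"
  proof (rule sum.cong[OF refl])
    fix e
    have "z powi k e * z powi (- k e) = 1" using assms by (simp add: power_int_minus)
    moreover have "(\<Sum>b\<in>UNIV. F (e, b)) = F (e, True) + F (e, False)"
      by (simp add: UNIV_bool)
    moreover have "c' * (p1 * (g1 - Z * g2)) + c' * (p2 * (g2 - Z' * g1)) = c' * (p1 - Z' * p2) * (g1 - Z * g2)"
      if "Z * Z' = 1" for c' p1 p2 g1 g2 Z Z' :: complex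
    proof -
      have "c' * (p1 - Z' * p2) * (g1 - Z * g2) =
        c' * (p1 * (g1 - Z * g2)) + c' * (p2 * ((Z * Z') * g2 - Z' * g1))" by (simp add: algebra_simps)
      then show ?thesis using that by simp
    qed
    ultimately show "(\<Sum>b\<in>UNIV. F (e, b)) =
      of_real (c e) * (p $ tail N e - z powi (- k e) * p $ head N e) *
        (g $ tail N e - z powi k e * g $ head N e)"
      by (simp add: F_def dart_tail_def dart_head_def dart_gain_def mult.assoc)
  qed
  finally show ?thesis .
qed

lemma matrix_entry_bilinear:
  fixes A :: "'a::comm_ring_1 ^ 'n ^ 'n"
  shows "A $ i $ j = (\<Sum>u\<in>UNIV. axis i 1 $ u * (A *v axis j 1) $ u)"
proof -
  have "(\<Sum>u\<in>UNIV. axis i 1 $ u * x $ u) = x $ i" for x :: "'a ^ 'n"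
    by (simp add: axis_def if_distrib[of "\<lambda>x. x * _"] cong: if_cong)
  moreover have "(A *v axis j 1) $ i = A $ i $ j"
    by (simp add: matrix_vector_mult_def axis_def if_distrib[of "\<lambda>x. _ * x"] cong: if_cong)
  ultimately show ?thesis by simp
qed

text \<open>Inverting \<open>z\<close> exchanges the two gradients in Green's identity, that is, the
  two arguments of the form.\<close>

lemma gain_laplacian_inverse:
  assumes "finite (edges N)" "z \<noteq> 0"
  shows "gain_laplacian N k c (1 / z) = transpose (gain_laplacian N k c z)"
proof -
  have *: "(1 / z) powi n = z powi (- n)" for n
    by (simp add: power_int_minus power_int_divide_distrib inverse_eq_divide)
  show ?thesis
    using assms unfolding vec_eq_iff transpose_def vec_lambda_beta
    by (subst (1 2) matrix_entry_bilinear, subst (1 2) gain_laplacian_bilinear)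
       (auto intro!: sum.cong simp: *)
qed

lemma det_gain_laplacian_inverse:
  "finite (edges N) \<Longrightarrow> z \<noteq> 0 \<Longrightarrow> det (gain_laplacian N k c (1 / z)) = det (gain_laplacian N k c z)"
  by (simp add: gain_laplacian_inverse det_transpose)

lemma det_eq_0_iff_ker:
  fixes A :: "complex ^ 'n ^ 'n"
  shows "det A = 0 \<longleftrightarrow> (\<exists>x. x \<noteq> 0 \<and> A *v x = 0)"
  using invertible_det_nz[of A] matrix_left_invertible_ker[of A] invertible_left_inverse[of A] by blast

section \<open>Roots are positive\<close>

text \<open>Row \<open>u\<close> of the kernel equation, multiplied by
  \<open>\<alpha> * z powi n\<close>, is harmonicity at \<open>(u, n)\<close>. The free factor
  \<alpha> serves to normalise the value at a chosen vertex.\<close>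

lemma harmonic_kernel:
  fixes f :: "complex ^ 'v::finite"
  assumes "gain_laplacian N k c z *v f = 0" "z \<noteq> 0"
  shows "harmonic N k c (\<lambda>y. Re (\<alpha> * z powi snd y * f $ fst y))"
proof -
  have "(\<Sum>d | d \<in> darts N \<and> dart_tail N d = u. c (fst d) *
          (Re (\<alpha> * z powi n * f $ u) - Re (\<alpha> * z powi (n + dart_gain k d) * f $ dart_head N d))) =
        Re (\<alpha> * z powi n * (gain_laplacian N k c z *v f) $ u)" for u n
    unfolding gain_laplacian_mult sum_distrib_left Re_sum
  proof (rule sum.cong[OF refl])
    fix d
    have Re: "Re (of_real C * (X - Y)) = C * (Re X - Re Y)" for C and X Y :: complex by simp
    have "\<alpha> * z powi n * (of_real (c (fst d)) * (f $ u - z powi dart_gain k d * f $ dart_head N d)) =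
      of_real (c (fst d)) * (\<alpha> * z powi n * f $ u - \<alpha> * z powi (n + dart_gain k d) * f $ dart_head N d)"
      using assms(2) by (simp add: power_int_add algebra_simps)
    then show "c (fst d) *
        (Re (\<alpha> * z powi n * f $ u) - Re (\<alpha> * z powi (n + dart_gain k d) * f $ dart_head N d)) =
      Re (\<alpha> * z powi n * (of_real (c (fst d)) * (f $ u - z powi dart_gain k d * f $ dart_head N d)))"
      using Re[of "c (fst d)"] by metis
  qed
  then show ?thesis
    by (simp only: harmonic_def fst_conv snd_conv assms(1) zero_index mult_zero_right zero_complex.sel simp_thms)
qed

lemma kernel_decay:
  fixes f :: "complex ^ 'v::finite"
  assumes z: "cmod z > 1" and "\<epsilon> > 0"
  shows "\<exists>m. \<forall>u n. n < m \<longrightarrow> \<bar>Re (\<alpha> * z powi n * f $ u)\<bar> < \<epsilon>"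
proof -
  define K where "K = cmod \<alpha> * (\<Sum>u\<in>UNIV. cmod (f $ u)) + 1"
  have K: "cmod \<alpha> * cmod (f $ u) < K" for u
  proof -
    have "cmod \<alpha> * cmod (f $ u) \<le> cmod \<alpha> * (\<Sum>u\<in>UNIV. cmod (f $ u))"
      by (intro mult_left_mono member_le_sum) auto
    then show ?thesis by (simp add: K_def)
  qed
  have "K > 0" using K[of undefined] by (meson le_less_trans mult_nonneg_nonneg norm_ge_zero)
  obtain j where j: "(1 / cmod z) ^ j < \<epsilon> / K"
  proof -
    have "z \<noteq> 0" using z by auto
    then have "1 / cmod z < 1" using z by (simp add: divide_less_eq)
    moreover have "\<epsilon> / K > 0" using assms \<open>K > 0\<close> by simp
    ultimately have "\<exists>j. (1 / cmod z) ^ j < \<epsilon> / K" by (intro real_arch_pow_inv)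
    then show ?thesis using that by blast
  qed
  have "\<bar>Re (\<alpha> * z powi n * f $ u)\<bar> < \<epsilon>" if "n < - int j" for u n
  proof -
    have "cmod z powi n \<le> cmod z powi (- int j)"
      using that z by (intro power_int_increasing) auto
    also have "\<dots> = (1 / cmod z) ^ j" by (simp add: power_int_minus power_divide inverse_eq_divide)
    finally have zn: "cmod z powi n < \<epsilon> / K" using j by simp
    have "\<bar>Re (\<alpha> * z powi n * f $ u)\<bar> \<le> cmod (\<alpha> * z powi n * f $ u)" by (rule abs_Re_le_cmod)
    also have "\<dots> = cmod z powi n * (cmod \<alpha> * cmod (f $ u))"
      by (simp add: norm_mult norm_power_int)
    also have "\<dots> \<le> cmod z powi n * K"
      using K[of u] by (intro mult_left_mono) auto
    also have "\<dots> < \<epsilon>" using zn \<open>K > 0\<close> by (simp add: field_simps)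
    finally show ?thesis .
  qed
  then show ?thesis by blast
qed

context annular_network
begin

text \<open>A path in the cover from \<open>(a, 0)\<close> to a vertex with non-zero value must
  leave the zero set somewhere; \<open>J\<close> bounds the levels of the finite piece before
  that.\<close>

lemma first_nonzero:
  fixes f :: "complex ^ 'v"
  assumes "f $ a = 0" "f \<noteq> 0"
  obtains J x d where "linked N k {y. f $ fst y = 0 \<and> \<bar>snd y\<bar> \<le> J} (a, 0) x"
    "d \<in> darts N" "dart_tail N d = fst x" "f $ dart_head N d \<noteq> 0"
proof -
  define Z where "Z J = {y :: 'v \<times> int. f $ fst y = 0 \<and> \<bar>snd y\<bar> \<le> J}" for J
  define G where "G = (\<exists>J x d. linked N k (Z J) (a, 0) x \<and> d \<in> darts N \<and>
    dart_tail N d = fst x \<and> f $ dart_head N d \<noteq> 0)"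
  have Z_mono: "Z J \<subseteq> Z J'" if "J \<le> J'" for J J' using that by (auto simp: Z_def)
  have "(\<exists>J. linked N k (Z J) (a, 0) y) \<or> G" if "linked N k UNIV (a, 0) y" for y
    using that
  proof (induction rule: linked_induct)
    case refl
    have "(a, 0) \<in> Z 0" using assms by (simp add: Z_def)
    then show ?case using linked_refl by blast
  next
    case (step d n)
    show ?case
    proof (cases G)
      case False
      then obtain J where J: "linked N k (Z J) (a, 0) (dart_tail N d, n)" using step by blast
      then have "f $ dart_head N d = 0" using False step(2) unfolding G_def by fastforce
      define J' where "J' = max J \<bar>n + dart_gain k d\<bar>"
      have "linked N k (Z J') (a, 0) (dart_tail N d, n)"
        using J Z_mono[of J J'] linked_mono by (auto simp: J'_def)
      moreover have "(dart_head N d, n + dart_gain k d) \<in> Z J'"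
        using \<open>f $ dart_head N d = 0\<close> by (simp add: Z_def J'_def)
      ultimately have "linked N k (Z J') (a, 0) (dart_head N d, n + dart_gain k d)"
        using linked_step[OF cover_adjI[OF step(2)]] linked_in linked_trans by metis
      then show ?thesis by blast
    qed auto
  qed
  moreover obtain u where "f $ u \<noteq> 0" using assms by (auto simp: vec_eq_iff)
  then have "\<not> linked N k (Z J) (a, 0) (u, 0)" for J
    using linked_in[of N k "Z J" "(a, 0)" "(u, 0)"] by (auto simp: Z_def)
  ultimately have G using cover_connected by blast
  then show ?thesis using that unfolding G_def Z_def by blast
qed

text \<open>Both claims refute the opposite by \<open>no_alternating_clusters\<close>. If
  \<open>f $ a = 0\<close>, a chain of zeros leads from each translate of \<open>a\<close> to a zero
  with neighbours of both signs. If \<open>z\<close> is not positive, the values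
  \<open>Re (z powi n)\<close> at the translates of \<open>a\<close> take both signs at arbitrarily
  low levels.\<close>

lemma kernel_expanding:
  fixes f :: "complex ^ 'v"
  assumes c: "positive_on_edges N c" and z: "cmod z > 1"
    and f: "gain_laplacian N k c z *v f = 0" "f \<noteq> 0"
  shows "f $ a \<noteq> 0" and "z = of_real (cmod z)"
proof -
  have "z \<noteq> 0" using z by auto
  note h = harmonic_kernel[OF f(1) this] and signs = Re_power_int_signs[OF \<open>z \<noteq> 0\<close>]
  have decay: "\<exists>m. \<forall>u n. n < m \<longrightarrow> \<bar>Re (\<alpha> * z powi snd (u, n) * f $ fst (u, n))\<bar> < \<epsilon>"
    if "\<epsilon> > 0" for \<alpha> \<epsilon>
    unfolding fst_conv snd_conv by (rule kernel_decay[OF z that])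
  have cancel: "1 / w * Z * w = Z" if "w \<noteq> 0" for w Z :: complex using that by simp
  show *: "f $ a \<noteq> 0"
  proof
    assume fa: "f $ a = 0"
    obtain J x d where *: "linked N k {y. f $ fst y = 0 \<and> \<bar>snd y\<bar> \<le> J} (a, 0) x"
      "d \<in> darts N" "dart_tail N d = fst x" "f $ dart_head N d \<noteq> 0"
      by (rule first_nonzero[OF fa f(2)]) (rule that)
    \<comment> \<open>With this normalisation the value at the head of \<open>d\<close> on level
      \<open>m\<close> is \<open>Re (z powi m)\<close>.\<close>
    define h where "h = (\<lambda>y. Re (1 / f $ dart_head N d * z powi snd y * f $ fst y))"
    have harm: "harmonic N k c h" unfolding h_def by (rule h)
    have x: "f $ fst x = 0" using linked_in[OF *(1)] by auto
    have key: "\<exists>n<b. (\<exists>y. h y > 0 \<and> linked N k (tube h J n) (a, n) y) \<and>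
       (\<exists>y. h y < 0 \<and> linked N k (tube (\<lambda>y. - h y) J n) (a, n) y)" for b
    proof -
      \<comment> \<open>The level of the head of \<open>d\<close> is chosen first, far enough down
        that the corresponding translate of \<open>a\<close> lies below \<open>b\<close>.\<close>
      obtain m where m: "m < b + (snd x + dart_gain k d)" "Re (z powi m) > 0"
        using signs(1) by blast
      define n where "n = m - (snd x + dart_gain k d)"
      have m_eq: "snd x + n + dart_gain k d = m" by (simp add: n_def)
      define Z where "Z = {w. (fst w, snd w - n) \<in> {y. f $ fst y = 0 \<and> \<bar>snd y\<bar> \<le> J}}"
      have l: "linked N k Z (a, n) (fst x, snd x + n)"
        using linked_shift[OF *(1), of n] by (simp add: Z_def)
      have Z: "Z \<subseteq> tube h J n" "Z \<subseteq> tube (\<lambda>y. - h y) J n"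
        by (auto simp: Z_def tube_def h_def)
      have nbr: "linked N k (tube g J n) (a, n) (dart_head N d', snd x + n + dart_gain k d')"
        if "Z \<subseteq> tube g J n" "d' \<in> darts N" "dart_tail N d' = fst x"
          "g (dart_head N d', snd x + n + dart_gain k d') > 0" for g d'
      proof -
        have 1: "linked N k (tube g J n) (a, n) (fst x, snd x + n)"
          using linked_mono[OF l that(1)] .
        have "linked N k (tube g J n) (fst x, snd x + n) (dart_head N d', snd x + n + dart_gain k d')"
          using cover_adjI[OF that(2), of "snd x + n" k] that linked_in[OF 1]
          by (intro linked_step) (auto simp: tube_def)
        with 1 show ?thesis by (rule linked_trans)
      qed
      have d_pos: "h (dart_head N d, snd x + n + dart_gain k d) > 0"
        using m(2) unfolding h_def fst_conv snd_conv m_eq cancel[OF *(4)] .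
      define D where "D = {d' \<in> darts N. dart_tail N d' = fst x}"
      have D: "finite D" "d \<in> D" using finite_darts[OF fin] * by (auto simp: D_def)
      define g where "g d' = c (fst d') * h (dart_head N d', snd x + n + dart_gain k d')" for d'
      have c_pos: "c (fst d') > 0" if "d' \<in> D" for d'
        using that c by (auto simp: positive_on_edges_def D_def darts_def)
      have "h (fst x, snd x + n) = 0" using x by (simp add: h_def)
      then have "sum g D = 0"
        using harm[unfolded harmonic_def, rule_format, of "fst x" "snd x + n"]
        by (simp add: D_def g_def sum_negf)
      \<comment> \<open>Harmonicity at a zero makes the weighted values of the neighbours sum to 0,
        so a positive neighbour forces a negative one.\<close>
      have "\<exists>d'\<in>D. g d' < 0"
      proof (rule ccontr)
        assume "\<not> ?thesis"
        then have "\<And>d'. d' \<in> D \<Longrightarrow> 0 \<le> g d'" by force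
        then have "g d = 0" using sum_nonneg_eq_0_iff[of D g] D \<open>sum g D = 0\<close> by auto
        then show False using c_pos[OF D(2)] d_pos by (simp add: g_def)
      qed
      then obtain d' where d': "d' \<in> D" "h (dart_head N d', snd x + n + dart_gain k d') < 0"
        using c_pos by (metis g_def mult_nonneg_nonneg less_imp_le not_le)
      have "n < b" using m by (simp add: n_def)
      moreover have "linked N k (tube h J n) (a, n) (dart_head N d, snd x + n + dart_gain k d)"
        using nbr[OF Z(1) *(2,3) d_pos] .
      moreover have "linked N k (tube (\<lambda>y. - h y) J n) (a, n) (dart_head N d', snd x + n + dart_gain k d')"
        using nbr[OF Z(2)] d' by (simp add: D_def)
      ultimately show ?thesis using d_pos d'(2) by blast
    qed
    have "\<exists>m. \<forall>u n. n < m \<longrightarrow> \<bar>h (u, n)\<bar> < \<epsilon>" if "\<epsilon> > 0" for \<epsilon>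
      unfolding h_def by (rule decay[OF that])
    then show False
      by (rule no_alternating_clusters[OF c harm]) (use key in blast)+
  qed
  show "z = of_real (cmod z)"
  proof (rule ccontr)
    assume ne: "z \<noteq> of_real (cmod z)"
    \<comment> \<open>Normalised to 1 at \<open>a\<close>, the signs sit on the translates of
      \<open>a\<close> themselves, so tubes with \<open>J = 0\<close> suffice.\<close>
    define h where "h = (\<lambda>y. Re (1 / f $ a * z powi snd y * f $ fst y))"
    have harm: "harmonic N k c h" unfolding h_def by (rule h)
    have h_a: "h (a, n) = Re (z powi n)" for n
      unfolding h_def fst_conv snd_conv cancel[OF *] ..
    have start: "linked N k (tube g 0 n) (a, n) (a, n)" if "g (a, n) > 0" for g n
      using that by (intro linked_refl) (simp add: tube_def)
    have "\<exists>n<b. \<exists>x. h x > 0 \<and> linked N k (tube h 0 n) (a, n) x" for b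
      using signs(1)[of b] start[of h] unfolding h_a[symmetric] by blast
    moreover have "\<exists>n<b. \<exists>x. h x < 0 \<and> linked N k (tube (\<lambda>y. - h y) 0 n) (a, n) x" for b
      using signs(2)[OF ne, of b] start[of "\<lambda>y. - h y"] unfolding h_a[symmetric] neg_0_less_iff_less
      by blast
    moreover have "\<exists>m. \<forall>u n. n < m \<longrightarrow> \<bar>h (u, n)\<bar> < \<epsilon>" if "\<epsilon> > 0" for \<epsilon>
      unfolding h_def by (rule decay[OF that])
    ultimately show False
      by (intro no_alternating_clusters[OF c harm, of 0])
  qed
qed

end

lemma gain_laplacian_uminus:
  "gain_laplacian N (\<lambda>e. - k e) c (1 / z) = gain_laplacian N k c z"
proof -
  have "(1 / z) powi dart_gain (\<lambda>e. - k e) d = z powi dart_gain k d" for d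
    by (simp add: dart_gain_def power_int_minus power_int_divide_distrib inverse_eq_divide)
  then show ?thesis by (simp add: gain_laplacian_def)
qed

context annular_network
begin

text \<open>Inside the unit disc the mirrored network is used: its matrix at \<open>1 / z\<close> is
  the given one, and \<open>1 / z\<close> lies outside the disc.\<close>

lemma kernel_off_unit_circle:
  fixes f :: "complex ^ 'v"
  assumes c: "positive_on_edges N c" and z: "cmod z \<noteq> 1" "z \<noteq> 0"
    and f: "gain_laplacian N k c z *v f = 0" "f \<noteq> 0"
  shows "f $ a \<noteq> 0 \<and> z = of_real (cmod z)"
proof (cases "cmod z > 1")
  case True
  then show ?thesis using kernel_expanding[OF c _ f] by blast
next
  case False
  interpret m: annular_network N "\<lambda>e. - k e" a by (rule mirrored)
  have "cmod (1 / z) > 1" using False z by (simp add: norm_divide field_simps)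
  then have "f $ a \<noteq> 0" "1 / z = of_real (cmod (1 / z))"
    using m.kernel_expanding[OF c _ _ f(2), of "1 / z"] f(1) by (auto simp: gain_laplacian_uminus)
  then have "1 / z = 1 / of_real (cmod z)" by (simp add: norm_divide)
  then show ?thesis using \<open>f $ a \<noteq> 0\<close> z by (simp add: field_simps)
qed

lemma transported_closed:
  fixes f :: "complex ^ 'v"
  assumes "z \<noteq> 0" and inv: "\<And>e. e \<in> edges N \<Longrightarrow> f $ tail N e = z powi k e * f $ head N e"
  shows "walk N u ds v \<Longrightarrow> f $ u = z powi gain k ds * f $ v"
proof (induction ds arbitrary: u)
  case (Cons d ds)
  then have d: "d \<in> darts N" "dart_tail N d = u" "f $ dart_head N d = z powi gain k ds * f $ v"
    by auto
  have "f $ u = z powi dart_gain k d * f $ dart_head N d"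
    using d(1,2) inv[of "fst d"] assms(1)
    by (auto simp: dart_tail_def dart_head_def dart_gain_def darts_def power_int_minus)
  then show ?case using d(3) assms(1) by (simp add: power_int_add)
qed simp

text \<open>Transport around a closed walk of gain 1 multiplies a non-zero value by \<open>z\<close>
  and returns it unchanged.\<close>

lemma transported_imp_one:
  fixes f :: "complex ^ 'v"
  assumes "z \<noteq> 0" "f \<noteq> 0" and inv: "\<And>e. e \<in> edges N \<Longrightarrow> f $ tail N e = z powi k e * f $ head N e"
  shows "z = 1"
proof -
  obtain u where "f $ u \<noteq> 0" using assms(2) by (auto simp: vec_eq_iff)
  moreover obtain ds where "walk N u ds u" "gain k ds = 1" using closed_walk_gain_one by blast
  ultimately show ?thesis using transported_closed[OF assms(1) inv, of u ds u] by simp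
qed

end

text \<open>For unimodular \<open>z\<close> conjugation inverts the transports, so the gradient of
  \<open>cnj g\<close> in Green's identity is the conjugate of that of \<open>g\<close>.\<close>

lemma energy_unit_circle:
  fixes g :: "complex ^ 'v::finite"
  assumes "finite (edges N)" "cmod z = 1"
  shows "(\<Sum>u\<in>UNIV. cnj (g $ u) * (gain_laplacian N k c z *v g) $ u) =
    of_real (\<Sum>e\<in>edges N. c e * (cmod (g $ tail N e - z powi k e * g $ head N e))\<^sup>2)"
proof -
  have "z \<noteq> 0" using assms by auto
  have cnj: "cnj z powi n = z powi (- n)" for n
  proof -
    have "z powi n * cnj (z powi n) = 1"
      using complex_norm_square[of "z powi n"] assms by (simp add: norm_power_int)
    then have "inverse (z powi n) = cnj (z powi n)" by (rule inverse_unique)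
    then show ?thesis by (simp add: power_int_minus complex_cnj_power_int)
  qed
  have "(\<Sum>u\<in>UNIV. cnj (g $ u) * (gain_laplacian N k c z *v g) $ u) =
     (\<Sum>u\<in>UNIV. (\<chi> u. cnj (g $ u)) $ u * (gain_laplacian N k c z *v g) $ u)" by simp
  also have "\<dots> = (\<Sum>e\<in>edges N. of_real (c e) * cnj (g $ tail N e - z powi k e * g $ head N e) *
        (g $ tail N e - z powi k e * g $ head N e))"
    by (subst gain_laplacian_bilinear[OF assms(1) \<open>z \<noteq> 0\<close>]) (simp add: cnj)
  also have "\<dots> = of_real (\<Sum>e\<in>edges N. c e * (cmod (g $ tail N e - z powi k e * g $ head N e))\<^sup>2)"
    unfolding of_real_sum
    by (intro sum.cong refl)
       (simp only: of_real_mult complex_norm_square mult.assoc mult.commute[of "cnj _"])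
  finally show ?thesis .
qed

lemma energy_eq_0:
  fixes g :: "complex ^ 'v::finite"
  assumes "finite (edges N)" "positive_on_edges N c"
    "(\<Sum>e\<in>edges N. c e * (cmod (g $ tail N e - z powi k e * g $ head N e))\<^sup>2) = 0" "e \<in> edges N"
  shows "g $ tail N e = z powi k e * g $ head N e"
proof -
  have "c e * (cmod (g $ tail N e - z powi k e * g $ head N e))\<^sup>2 = 0"
    using assms sum_nonneg_eq_0_iff[of "edges N" "\<lambda>e. c e * (cmod (g $ tail N e - z powi k e * g $ head N e))\<^sup>2"]
    by (force simp: positive_on_edges_def less_imp_le)
  then show ?thesis using assms by (auto simp: positive_on_edges_def)
qed

lemma (in annular_network) kernel_unit_circle:
  fixes f :: "complex ^ 'v"
  assumes c: "positive_on_edges N c" and z: "cmod z = 1"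
    and f: "gain_laplacian N k c z *v f = 0" "f \<noteq> 0"
  shows "z = 1"
proof (rule transported_imp_one[OF _ f(2)])
  show "z \<noteq> 0" using z by auto
  have "(\<Sum>e\<in>edges N. c e * (cmod (f $ tail N e - z powi k e * f $ head N e))\<^sup>2) = 0"
    using energy_unit_circle[OF fin z, of f k c] f(1) by (simp del: of_real_sum)
  then show "f $ tail N e = z powi k e * f $ head N e" if "e \<in> edges N" for e
    using energy_eq_0[OF fin c] that by blast
qed

lemma (in annular_network) root_positive:
  assumes c: "positive_on_edges N c" and z: "z \<noteq> 0" "det (gain_laplacian N k c z) = 0"
  shows "z = of_real (cmod z)"
proof -
  obtain f where f: "f \<noteq> 0" "gain_laplacian N k c z *v f = 0"
    using z(2) det_eq_0_iff_ker by blast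
  show ?thesis
  proof (cases "cmod z = 1")
    case True
    then show ?thesis using kernel_unit_circle[OF c True f(2,1)] by simp
  next
    case False
    then show ?thesis using kernel_off_unit_circle[OF c False z(1) f(2,1)] by simp
  qed
qed

section \<open>Simple roots\<close>

text \<open>
  Consider the vertices with \<open>F \<noteq> 0\<close> at an edge where \<open>G\<close> is not flat.  Since \<open>F\<close> is flat
  along such edges, \<open>F G\<close> is harmonic on the graph they form, hence constant along them.
\<close>

lemma flat_at_nonzero:
  fixes N :: "('v::finite, 'e) network" and F G :: "'v \<Rightarrow> real"
  assumes fin: "finite (edges N)" and c: "positive_on_edges N c"
    and w: "\<And>d. d \<in> darts N \<Longrightarrow> w d * w (rev_dart d) = 1"
    and G: "\<And>u. (\<Sum>d | d \<in> darts N \<and> dart_tail N d = u.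
      c (fst d) * (G u - w (rev_dart d) * G (dart_head N d))) = 0"
    and flat: "\<And>d. d \<in> darts N \<Longrightarrow> F (dart_tail N d) = w d * F (dart_head N d) \<or>
      G (dart_tail N d) = w (rev_dart d) * G (dart_head N d)"
    and d: "d \<in> darts N" and "F (dart_tail N d) \<noteq> 0"
  shows "G (dart_tail N d) = w (rev_dart d) * G (dart_head N d)"
proof (rule ccontr)
  assume ne: "\<not> ?thesis"
  define bad where "bad d \<longleftrightarrow> d \<in> darts N \<and> G (dart_tail N d) \<noteq> w (rev_dart d) * G (dart_head N d)" for d
  define U where "U = {u. F u \<noteq> 0 \<and> (\<exists>d. bad d \<and> dart_tail N d = u)}"
  have "bad d" using ne d by (simp add: bad_def)
  then have "dart_tail N d \<in> U" using assms(7) unfolding U_def by blast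
  then have U: "finite ((\<lambda>u. F u * G u) ` U)" "(\<lambda>u. F u * G u) ` U \<noteq> {}" by auto
  obtain u where u: "u \<in> U" "Max ((\<lambda>u. F u * G u) ` U) = F u * G u"
    using Max_in[OF U] by blast
  have max: "F v * G v \<le> F u * G u" if "v \<in> U" for v
    unfolding u(2)[symmetric] using that U by (intro Max_ge) auto
  define D where "D = {d. d \<in> darts N \<and> dart_tail N d = u}"
  \<comment> \<open>On a bad dart \<open>F\<close> is flat, so this is the conductance times the
    drop of \<open>F * G\<close> along the dart; on other darts it is 0.\<close>
  define \<Delta> where "\<Delta> d = c (fst d) * (F u * (G u - w (rev_dart d) * G (dart_head N d)))" for d
  have c_pos: "c (fst d) > 0" if "d \<in> darts N" for d
    using that c by (auto simp: positive_on_edges_def darts_def)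
  have "\<Delta> d \<ge> 0" if "d \<in> D" for d
  proof (cases "bad d")
    case False
    then show ?thesis using that by (auto simp: D_def bad_def \<Delta>_def)
  next
    case True
    then have d: "d \<in> darts N" "dart_tail N d = u" using that by (auto simp: D_def)
    have F: "F u = w d * F (dart_head N d)"
      using flat[OF d(1)] True d by (auto simp: bad_def)
    have "bad (rev_dart d)"
    proof -
      have "G (dart_tail N d) = w (rev_dart d) * (w d * G (dart_tail N d))"
        using w[OF d(1)] by (simp add: mult.assoc[symmetric] mult.commute)
      then show ?thesis using True by (auto simp: bad_def)
    qed
    moreover have "F (dart_head N d) \<noteq> 0" using F u(1) by (auto simp: U_def)
    moreover have "dart_tail N (rev_dart d) = dart_head N d" by simp
    ultimately have "dart_head N d \<in> U" unfolding U_def by blast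
    then have "F (dart_head N d) * G (dart_head N d) \<le> F u * G u" by (rule max)
    moreover have eq: "F u * (w (rev_dart d) * G (dart_head N d)) =
        (w d * w (rev_dart d)) * (F (dart_head N d) * G (dart_head N d))"
      unfolding F by (simp add: algebra_simps)
    ultimately have "F u * (w (rev_dart d) * G (dart_head N d)) \<le> F u * G u"
      unfolding eq w[OF d(1)] mult_1 by blast
    then show ?thesis using c_pos[OF d(1)] by (simp add: \<Delta>_def right_diff_distrib)
  qed
  moreover have "sum \<Delta> D = F u * (\<Sum>d\<in>D. c (fst d) * (G u - w (rev_dart d) * G (dart_head N d)))"
    unfolding sum_distrib_left \<Delta>_def by (intro sum.cong) (auto simp: algebra_simps)
  then have "sum \<Delta> D = 0" using G[of u] by (simp add: D_def)
  moreover have "finite D" using finite_darts[OF fin] by (simp add: D_def)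
  ultimately have zero: "\<Delta> d = 0" if "d \<in> D" for d
    using sum_nonneg_eq_0_iff[of D \<Delta>] that by auto
  obtain d' where "bad d'" "dart_tail N d' = u" "F u \<noteq> 0" using u(1) by (auto simp: U_def)
  then show False using zero[of d'] c_pos[of d'] by (auto simp: D_def bad_def \<Delta>_def)
qed

text \<open>
  Otherwise the two gradients have disjoint supports; starting at \<open>a\<close>, both functions are then flat and non-zero
  at every vertex, which forces \<open>x = 1\<close>.
\<close>

lemma (in annular_network) common_gradient_edge_real:
  fixes F G :: "'v \<Rightarrow> real"
  assumes c: "positive_on_edges N c" and x: "x \<noteq> 0" "x \<noteq> 1"
    and F: "\<And>u. (\<Sum>d | d \<in> darts N \<and> dart_tail N d = u.
      c (fst d) * (F u - x powi dart_gain k d * F (dart_head N d))) = 0"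
    and G: "\<And>u. (\<Sum>d | d \<in> darts N \<and> dart_tail N d = u.
      c (fst d) * (G u - x powi (- dart_gain k d) * G (dart_head N d))) = 0"
    and a: "F a \<noteq> 0" "G a \<noteq> 0"
  shows "\<exists>e\<in>edges N. F (tail N e) \<noteq> x powi k e * F (head N e) \<and>
    G (tail N e) \<noteq> x powi (- k e) * G (head N e)"
proof (rule ccontr)
  assume contra: "\<not> ?thesis"
  define w where "w d = x powi dart_gain k d" for d
  have w: "w d * w (rev_dart d) = 1" for d using x by (simp add: w_def power_int_minus)
  have flat: "F (dart_tail N d) = w d * F (dart_head N d) \<or>
      G (dart_tail N d) = w (rev_dart d) * G (dart_head N d)" if dart: "d \<in> darts N" for d
  proof -
    obtain e b where d: "d = (e, b)" "e \<in> edges N" using dart by (auto simp: darts_def)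
    then have "F (tail N e) = x powi k e * F (head N e) \<or> G (tail N e) = x powi (- k e) * G (head N e)"
      using contra by blast
    then show ?thesis
      using x unfolding w_def rev_dart_simps d(1)
      by (cases b) (auto simp: dart_tail_def dart_head_def dart_gain_def power_int_minus field_simps)
  qed
  have G': "(\<Sum>d | d \<in> darts N \<and> dart_tail N d = u.
      c (fst d) * (G u - w (rev_dart d) * G (dart_head N d))) = 0" for u
    using G[of u] by (simp add: w_def)
  have F': "(\<Sum>d | d \<in> darts N \<and> dart_tail N d = u.
      c (fst d) * (F u - w (rev_dart (rev_dart d)) * F (dart_head N d))) = 0" for u
    using F[of u] by (simp add: w_def)
  have fG: "G (dart_tail N d) = w (rev_dart d) * G (dart_head N d)"
    if "d \<in> darts N" "F (dart_tail N d) \<noteq> 0" for d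
    using flat_at_nonzero[OF fin c w G' flat that] .
  have fF: "F (dart_tail N d) = w d * F (dart_head N d)"
    if "d \<in> darts N" "G (dart_tail N d) \<noteq> 0" for d
  proof -
    define w' where "w' d = w (rev_dart d)" for d
    have "F (dart_tail N d) = w' (rev_dart d) * F (dart_head N d)"
    proof (rule flat_at_nonzero[where F=G and G=F and w=w', OF fin c _ _ _ that])
      show "w' d * w' (rev_dart d) = 1" for d using w[of "rev_dart d"] by (simp add: w'_def)
      show "(\<Sum>d | d \<in> darts N \<and> dart_tail N d = u.
        c (fst d) * (F u - w' (rev_dart d) * F (dart_head N d))) = 0" for u
        unfolding w'_def by (rule F')
      show "G (dart_tail N d) = w' d * G (dart_head N d) \<or>
        F (dart_tail N d) = w' (rev_dart d) * F (dart_head N d)" if "d \<in> darts N" for d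
        using flat[OF that] by (auto simp: w'_def)
    qed
    then show ?thesis by (simp add: w'_def)
  qed
  have w0: "w d \<noteq> 0" for d using x by (simp add: w_def)
  have "walk N u ds v \<Longrightarrow> F u \<noteq> 0 \<and> G u \<noteq> 0 \<Longrightarrow> F v \<noteq> 0 \<and> G v \<noteq> 0" for u v ds
  proof (induction ds arbitrary: u)
    case (Cons d ds)
    then have d: "d \<in> darts N" "dart_tail N d = u" by auto
    have "F (dart_head N d) \<noteq> 0 \<and> G (dart_head N d) \<noteq> 0"
      using fF[OF d(1)] fG[OF d(1)] Cons.prems(2) d(2) by auto
    then show ?case using Cons by auto
  qed auto
  then have nz: "F v \<noteq> 0 \<and> G v \<noteq> 0" for v using a conn by meson
  define f where "f = (\<chi> u. complex_of_real (F u))"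
  have "of_real x = (1 :: complex)"
  proof (rule transported_imp_one[of _ f])
    show "complex_of_real x \<noteq> 0" using x by simp
    show "f \<noteq> 0" using nz by (auto simp: f_def vec_eq_iff)
    fix e assume e: "e \<in> edges N"
    have "F (tail N e) = x powi k e * F (head N e)"
      using fF[of "(e, True)"] nz e
      by (simp add: darts_def w_def dart_tail_def dart_head_def dart_gain_def)
    then show "f $ tail N e = of_real x powi k e * f $ head N e"
      by (simp add: f_def)
  qed
  then show False using x by simp
qed

text \<open>Off the unit circle kernel vectors do not vanish at \<open>a\<close>, so they can be
  divided by their value there. As the transports are real, the real parts still satisfy the kernel
  equation, and an edge that is flat for the complex vector is flat for its real part.\<close>

lemma (in annular_network) common_gradient_edge:
  fixes f g :: "complex ^ 'v"
  assumes c: "positive_on_edges N c" and x: "x > 0" "x \<noteq> 1"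
    and f: "gain_laplacian N k c (of_real x) *v f = 0" "f \<noteq> 0"
    and g: "gain_laplacian N k c (1 / of_real x) *v g = 0" "g \<noteq> 0"
  shows "\<exists>e\<in>edges N. f $ tail N e \<noteq> of_real x powi k e * f $ head N e \<and>
    g $ tail N e \<noteq> of_real x powi (- k e) * g $ head N e"
proof -
  define R where "R h u = Re (h $ u / h $ a)" for h :: "complex ^ 'v" and u
  have Re: "Re ((of_real C * (X - of_real y * Y)) / W) = C * (Re (X / W) - y * Re (Y / W))"
    for C y and X Y W :: complex
  proof -
    have "(of_real C * (X - of_real y * Y)) / W = of_real C * (X / W - of_real y * (Y / W))"
      by (simp add: diff_divide_distrib algebra_simps)
    moreover have "Re (of_real r * Z) = r * Re Z" for r Z by simp
    ultimately show ?thesis by (simp only: minus_complex.sel)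
  qed
  have eq: "(\<Sum>d | d \<in> darts N \<and> dart_tail N d = u.
      c (fst d) * (R h u - y powi dart_gain k d * R h (dart_head N d))) = 0"
    if "gain_laplacian N k c (of_real y) *v h = 0" for y u h
  proof -
    have "(\<Sum>d | d \<in> darts N \<and> dart_tail N d = u.
      c (fst d) * (R h u - y powi dart_gain k d * R h (dart_head N d))) =
      Re ((gain_laplacian N k c (of_real y) *v h) $ u / h $ a)"
      unfolding gain_laplacian_mult sum_divide_distrib Re_sum of_real_power_int[symmetric] Re R_def ..
    then show ?thesis using that by simp
  qed
  have inv: "(1 / x) powi n = x powi (- n)" for n
    by (simp add: power_int_minus power_int_divide_distrib inverse_eq_divide)
  have "(\<Sum>d | d \<in> darts N \<and> dart_tail N d = u.
      c (fst d) * (R g u - x powi (- dart_gain k d) * R g (dart_head N d))) = 0" for u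
    using eq[of "1 / x" g u] g(1) unfolding inv by simp
  moreover have "cmod (of_real x) \<noteq> 1" "cmod (1 / of_real x) \<noteq> 1"
    using x by (auto simp: norm_divide)
  then have "f $ a \<noteq> 0" "g $ a \<noteq> 0"
    using kernel_off_unit_circle[OF c _ _ f] kernel_off_unit_circle[OF c _ _ g] x by auto
  then have "R f a \<noteq> 0" "R g a \<noteq> 0" by (auto simp: R_def)
  ultimately obtain e where e: "e \<in> edges N" "R f (tail N e) \<noteq> x powi k e * R f (head N e)"
    "R g (tail N e) \<noteq> x powi (- k e) * R g (head N e)"
    using common_gradient_edge_real[OF c _ x(2) eq[OF f(1)], of "R g"] x(1) by auto
  have "R h u = y * R h v" if "h $ u = of_real y * h $ v" for h u v y
    using that by (simp add: R_def times_divide_eq_right[symmetric] del: times_divide_eq_right)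
  then show ?thesis using e by (metis of_real_power_int)
qed

section \<open>Dependence of the determinant on one conductance\<close>

lemma det_add_row_multiple:
  fixes A :: "'a::comm_ring_1 ^ 'n ^ 'n"
  shows "det (\<chi> i. if i = p then A $ i + s *s y else A $ i) =
    det A + s * det (\<chi> i. if i = p then y else A $ i)"
proof -
  have "(\<chi> i. if i = p then A $ i else A $ i) = A" by (simp add: vec_eq_iff)
  then show ?thesis by (simp only: det_row_add det_row_mul)
qed

text \<open>A rank-one perturbation changes a determinant affinely. Here it touches at most two
  rows, and a row operation concentrates it in one, where multilinearity applies.\<close>

lemma det_rank_one_update:
  fixes A :: "'a::field ^ 'n ^ 'n"
  assumes supp: "\<And>i. i \<noteq> p \<Longrightarrow> i \<noteq> q \<Longrightarrow> x i = 0"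
  shows "\<exists>D. \<forall>s. det (\<chi> i. A $ i + (s * x i) *s y) = det A + s * D"
proof -
  have one: ?thesis if "\<And>i. i \<noteq> p' \<Longrightarrow> x i = 0" for p'
  proof -
    have "(\<chi> i. A $ i + (s * x i) *s y) = (\<chi> i. if i = p' then A $ i + (s * x p') *s y else A $ i)" for s
      using that by (auto simp: vec_eq_iff)
    note eq = this
    show ?thesis
    proof (intro exI allI)
      show "det (\<chi> i. A $ i + (s * x i) *s y) =
        det A + s * (x p' * det (\<chi> i. if i = p' then y else A $ i))" for s
        unfolding eq det_add_row_multiple by (simp only: mult.assoc)
    qed
  qed
  consider "p = q" | "x p = 0" | "p \<noteq> q" "x p \<noteq> 0" by blast
  then show ?thesis
  proof cases
    case 1
    then show ?thesis using one[of p] supp by blast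
  next
    case 2
    then have "x i = 0" if "i \<noteq> q" for i using supp that by (cases "i = p") auto
    then show ?thesis by (rule one)
  next
    case 3
    define B where "B s = (\<chi> i. A $ i + (s * x i) *s y)" for s
    \<comment> \<open>Subtracting this multiple of row \<open>p\<close> cancels the perturbation in
      row \<open>q\<close>; only row \<open>p\<close> still depends on \<open>s\<close>.\<close>
    define C where "C s = (\<chi> i. if i = q then row q (B s) + (- x q / x p) *s row p (B s) else row i (B s))" for s
    have CB: "det (C s) = det (B s)" for s
      unfolding C_def using 3 by (intro det_row_operation) auto
    have cancel: "P + s * x q * Y + (- x q / x p) * (Q + s * x p * Y) = P + (- x q / x p) * Q" for P Q s Y
    proof -
      have "(- x q / x p) * (s * x p * Y) = - (s * x q * Y)" using 3 by simp
      then show ?thesis by (simp only: distrib_left) simp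
    qed
    have "C s $ i $ j = (if i = p then C 0 $ i + (s * x p) *s y else C 0 $ i) $ j" for s i j
    proof (cases "i = q")
      case True
      then show ?thesis using 3 cancel by (simp add: C_def B_def row_def)
    next
      case False
      then show ?thesis using supp[of i] by (cases "i = p") (simp_all add: C_def B_def row_def)
    qed
    then have C: "C s = (\<chi> i. if i = p then C 0 $ i + (s * x p) *s y else C 0 $ i)" for s
      by (simp only: vec_eq_iff vec_lambda_beta) blast
    have "B 0 = A" by (simp add: B_def vec_eq_iff)
    show ?thesis
    proof (intro exI allI)
      fix s
      have "det (B s) = det (\<chi> i. if i = p then C 0 $ i + (s * x p) *s y else C 0 $ i)"
        unfolding CB[symmetric] by (subst C) (rule refl)
      also have "\<dots> = det A + s * (x p * det (\<chi> i. if i = p then y else C 0 $ i))"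
        unfolding det_add_row_multiple CB \<open>B 0 = A\<close> by (simp only: mult.assoc)
      finally show "det (\<chi> i. A $ i + (s * x i) *s y) =
        det A + s * (x p * det (\<chi> i. if i = p then y else C 0 $ i))"
        unfolding B_def .
    qed
  qed
qed

text \<open>By Green's identity a conductance enters linearly, with the product of two gradient
  functionals of its edge as coefficient.\<close>

lemma gain_laplacian_fun_upd:
  assumes "finite (edges N)" "e \<in> edges N" "z \<noteq> 0"
  shows "gain_laplacian N k (c(e := c e + s)) z =
    (\<chi> i. gain_laplacian N k c z $ i +
      (of_real s * (axis i 1 $ tail N e - z powi (- k e) * axis i 1 $ head N e)) *s
      (\<chi> j. axis j 1 $ tail N e - z powi k e * axis j 1 $ head N e))"
proof -
  have "(\<Sum>e'\<in>edges N. of_real ((c(e := c e + s)) e') * X e' * Y e') =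
      (\<Sum>e'\<in>edges N. of_real (c e') * X e' * Y e') + of_real s * X e * Y e" for X Y :: "_ \<Rightarrow> complex"
  proof -
    have "(\<Sum>e'\<in>edges N. of_real ((c(e := c e + s)) e') * X e' * Y e') =
      (\<Sum>e'\<in>edges N. of_real (c e') * X e' * Y e' + (if e' = e then of_real s * X e * Y e else 0))"
      by (intro sum.cong) (auto simp: algebra_simps)
    then show ?thesis using assms by (simp add: sum.distrib)
  qed
  then show ?thesis
    using assms by (subst vec_eq_iff, intro allI, subst vec_eq_iff, intro allI,
      simp only: vec_lambda_beta vector_add_component vector_smult_component,
      subst (1 2) matrix_entry_bilinear, simp only: gain_laplacian_bilinear)
qed

text \<open>Writing the slope as the increment for \<open>s = 1\<close> exhibits it as a difference
  of two Laplacian determinants, hence as a Laurent polynomial in \<open>z\<close>.\<close>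

lemma det_gain_laplacian_affine:
  assumes "finite (edges N)" "e \<in> edges N" "z \<noteq> 0"
  shows "det (gain_laplacian N k (c(e := c e + s)) z) = det (gain_laplacian N k c z) +
    of_real s * (det (gain_laplacian N k (c(e := c e + 1)) z) - det (gain_laplacian N k c z))"
proof -
  define x where "x i = axis i 1 $ tail N e - z powi (- k e) * axis i 1 $ head N e" for i
  define y where "y = (\<chi> j. axis j 1 $ tail N e - z powi k e * axis j 1 $ head N e)"
  have "x i = 0" if "i \<noteq> tail N e" "i \<noteq> head N e" for i
    using that by (auto simp: x_def axis_def)
  then obtain D where D: "\<And>s. det (\<chi> i. gain_laplacian N k c z $ i + (s * x i) *s y) =
      det (gain_laplacian N k c z) + s * D"
    using det_rank_one_update[of "tail N e" "head N e" x "gain_laplacian N k c z" y] by blast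
  have "det (gain_laplacian N k (c(e := c e + s)) z) = det (gain_laplacian N k c z) + of_real s * D" for s
    unfolding gain_laplacian_fun_upd[OF assms] x_def[symmetric] y_def[symmetric] by (rule D)
  then show ?thesis by simp
qed

text \<open>Since \<open>g\<close> annihilates the range of the unperturbed matrix, pairing it with
  the perturbed kernel equation leaves only the product of the gradients of \<open>g\<close> and
  \<open>h\<close> at \<open>e\<close>. So \<open>h\<close> has zero gradient there and lies in the
  unperturbed kernel, the line of \<open>f\<close>, whose gradient is not zero.\<close>

lemma (in annular_network) det_perturbed_nonzero:
  fixes f g :: "complex ^ 'v"
  assumes c: "positive_on_edges N c" and z: "z \<noteq> 0" "cmod z \<noteq> 1"
    and f: "gain_laplacian N k c z *v f = 0" "f \<noteq> 0"
    and g: "gain_laplacian N k c (1 / z) *v g = 0"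
    and e: "e \<in> edges N" "f $ tail N e \<noteq> z powi k e * f $ head N e"
      "g $ tail N e \<noteq> z powi (- k e) * g $ head N e"
    and s: "s \<noteq> 0"
  shows "det (gain_laplacian N k (c(e := c e + s)) z) \<noteq> 0"
proof
  assume "det (gain_laplacian N k (c(e := c e + s)) z) = 0"
  then obtain h where h: "h \<noteq> 0" "gain_laplacian N k (c(e := c e + s)) z *v h = 0"
    using det_eq_0_iff_ker by blast
  define M where "M = gain_laplacian N k c z"
  define y where "y = (\<chi> j. axis j 1 $ tail N e - z powi k e * axis j (1::complex) $ head N e)"
  define x where "x i = axis i 1 $ tail N e - z powi (- k e) * axis i (1::complex) $ head N e" for i
  define \<delta> where "\<delta> h = h $ tail N e - z powi k e * h $ head N e" for h :: "complex ^ 'v"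
  have y: "(\<Sum>j\<in>UNIV. y $ j * h $ j) = \<delta> h" for h
    by (simp add: y_def \<delta>_def axis_def left_diff_distrib sum_subtractf sum_distrib_left[symmetric] mult.assoc
        if_distrib[of "\<lambda>x. x * _"] cong: if_cong)
  have x: "(\<Sum>i\<in>UNIV. g $ i * x i) = g $ tail N e - z powi (- k e) * g $ head N e"
    by (simp add: x_def axis_def right_diff_distrib sum_subtractf sum_distrib_left[symmetric] mult.left_commute
        if_distrib[of "\<lambda>x. _ * x"] cong: if_cong)
  have Mh: "(M *v h) $ i + of_real s * x i * \<delta> h = 0" for i
  proof -
    have "(gain_laplacian N k (c(e := c e + s)) z *v h) $ i =
      (\<Sum>j\<in>UNIV. (M $ i $ j + (of_real s * x i) * y $ j) * h $ j)"
      unfolding gain_laplacian_fun_upd[OF fin e(1) z(1)] matrix_vector_mult_def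
      by (simp add: M_def x_def y_def)
    also have "\<dots> = (M *v h) $ i + of_real s * x i * (\<Sum>j\<in>UNIV. y $ j * h $ j)"
      by (simp add: matrix_vector_mult_def distrib_right sum.distrib sum_distrib_left mult.assoc)
    finally show ?thesis using h(2) y by simp
  qed
  have "(\<Sum>i\<in>UNIV. g $ i * (M *v h) $ i) = (\<Sum>i\<in>UNIV. h $ i * (gain_laplacian N k c (1 / z) *v g) $ i)"
  proof -
    have "z powi n = (1 / z) powi (- n)" for n
      by (simp add: power_int_minus power_int_divide_distrib inverse_eq_divide)
    then show ?thesis unfolding M_def using z
      by (subst (1 2) gain_laplacian_bilinear[OF fin]) (auto simp: algebra_simps intro!: sum.cong)
  qed
  then have gM: "(\<Sum>i\<in>UNIV. g $ i * (M *v h) $ i) = 0" using g by simp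
  have "0 = (\<Sum>i\<in>UNIV. g $ i * ((M *v h) $ i + of_real s * x i * \<delta> h))" using Mh by simp
  also have "\<dots> = (\<Sum>i\<in>UNIV. g $ i * (M *v h) $ i) + of_real s * \<delta> h * (\<Sum>i\<in>UNIV. g $ i * x i)"
    by (simp add: distrib_left sum.distrib sum_distrib_left mult_ac)
  finally have "\<delta> h = 0" using gM x e(3) s by auto
  then have "M *v h = 0" using Mh by (simp add: vec_eq_iff)
  \<comment> \<open>The combination \<open>h - t *s f\<close> is a kernel vector vanishing at
    \<open>a\<close>, hence zero: the kernel is a line.\<close>
  define t where "t = h $ a / f $ a"
  have "f $ a \<noteq> 0" using kernel_off_unit_circle[OF c z(2,1) f] by blast
  have "M *v (h - t *s f) = 0"
    using \<open>M *v h = 0\<close> f(1) by (simp add: matrix_vector_mult_diff_distrib vector_scalar_commute M_def)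
  moreover have "(h - t *s f) $ a = 0" using \<open>f $ a \<noteq> 0\<close> by (simp add: t_def)
  ultimately have "h - t *s f = 0"
    using kernel_off_unit_circle[OF c z(2,1), of "h - t *s f"] unfolding M_def by blast
  then have ht: "h = t *s f" by simp
  then have "t * \<delta> f = 0" using \<open>\<delta> h = 0\<close> by (simp add: \<delta>_def algebra_simps)
  then have "t = 0" using e(2) by (simp add: \<delta>_def)
  then show False using ht h(1) by simp
qed

text \<open>Split off \<open>(z - 1) ^ m\<close>. Inversion turns this factor into itself times
  \<open>(- 1) ^ m / z ^ m\<close>, and letting \<open>z\<close> tend to 1 in the remaining identity
  gives \<open>(- 1) ^ m = 1\<close>.\<close>

lemma root_order_even:
  fixes p :: "complex poly" and P :: "complex \<Rightarrow> complex"
  assumes p: "p \<noteq> 0" and P: "\<And>z. z \<noteq> 0 \<Longrightarrow> P z = poly p z / z ^ n"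
    and inv: "\<And>z. z \<noteq> 0 \<Longrightarrow> P (1 / z) = P z"
  shows "even (order 1 p)"
proof -
  define m where "m = order 1 p"
  obtain q where q: "p = [:-1, 1:] ^ m * q" "\<not> [:-1, 1:] dvd q"
    using order_decomp[OF p, of 1] unfolding m_def by blast
  then have q1: "poly q 1 \<noteq> 0" by (simp add: poly_eq_0_iff_dvd)
  have eq: "z ^ m * poly q z = (-1) ^ m * z ^ (2 * n) * poly q (1 / z)" if z: "z \<noteq> 0" "z \<noteq> 1" for z
  proof -
    have "poly p (1 / z) * z ^ n = poly p z / z ^ n"
      using P[of "1 / z"] P[of z] inv[of z] z by (simp add: power_divide)
    then have "(poly p (1 / z) * z ^ n) * z ^ n = poly p z" using z by simp
    then have "z ^ (2 * n) * poly p (1 / z) = poly p z"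
      unfolding mult_2 power_add by (simp only: mult_ac)
    then have e1: "z ^ (2 * n) * ((1 / z - 1) ^ m * poly q (1 / z)) = (z - 1) ^ m * poly q z"
      by (simp add: q)
    have "1 / z - 1 = (- 1) * (z - 1) / z" using z by (simp add: field_simps)
    then have e2: "z ^ m * (1 / z - 1) ^ m = (- 1) ^ m * (z - 1) ^ m"
      using z by (simp add: power_mult_distrib[symmetric])
    have "(z - 1) ^ m * (z ^ m * poly q z) = z ^ m * ((z - 1) ^ m * poly q z)" by (rule mult.left_commute)
    also have "\<dots> = z ^ (2 * n) * (z ^ m * (1 / z - 1) ^ m) * poly q (1 / z)"
      unfolding e1[symmetric] by (simp only: mult.assoc mult.left_commute)
    also have "\<dots> = (z - 1) ^ m * ((-1) ^ m * z ^ (2 * n) * poly q (1 / z))"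
      unfolding e2 by (simp only: mult.assoc mult.left_commute)
    finally have "(z - 1) ^ m * (z ^ m * poly q z) =
      (z - 1) ^ m * ((-1) ^ m * z ^ (2 * n) * poly q (1 / z))" .
    then show ?thesis using z by simp
  qed
  define L where "L z = z ^ m * poly q z" for z
  define R where "R z = (-1) ^ m * z ^ (2 * n) * poly q (1 / z)" for z
  have "(L \<longlongrightarrow> 1 ^ m * poly q 1) (at 1)"
    unfolding L_def by (intro tendsto_intros)
  moreover have "eventually (\<lambda>z. L z = R z) (at 1)"
  proof -
    have "z \<noteq> 0" if "dist z 1 < 1" for z :: complex using that by auto
    then have "\<forall>z\<in>UNIV. z \<noteq> 1 \<and> dist z 1 < 1 \<longrightarrow> L z = R z"
      using eq unfolding L_def R_def by blast
    then show ?thesis unfolding eventually_at using zero_less_one by blast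
  qed
  ultimately have "(R \<longlongrightarrow> 1 ^ m * poly q 1) (at 1)" by (rule Lim_transform_eventually)
  moreover have "(R \<longlongrightarrow> (-1) ^ m * 1 ^ (2 * n) * poly q (1 / 1)) (at 1)"
    unfolding R_def by (intro tendsto_intros) auto
  ultimately have "1 ^ m * poly q 1 = (-1) ^ m * 1 ^ (2 * n) * poly q (1 / 1)"
    by (rule tendsto_unique[rotated]) simp
  then have "(-1) ^ m = (1 :: complex)" using q1 by simp
  then show ?thesis unfolding m_def[symmetric] by (cases "even m") auto
qed

text \<open>
  Near a zero of order \<open>m \<ge> 2\<close>, the quotient behaves like \<open>(z - x)\<^sup>m\<close> up to a constant, so its
  imaginary part changes sign along a small arc in the open upper half plane.
\<close>

lemma real_values_near_multiple_zero:
  fixes p d :: "complex poly" and x \<delta> :: real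
  assumes p: "p \<noteq> 0" and m: "2 \<le> order (of_real x) p" and x: "x \<noteq> 0"
    and d: "poly d (of_real x) \<noteq> 0" and \<delta>: "\<delta> > 0"
  shows "\<exists>z s. z \<noteq> 0 \<and> Im z \<noteq> 0 \<and> \<bar>s\<bar> < \<delta> \<and> poly p z / z ^ n + of_real s * (poly d z / z ^ n') = 0"
proof -
  define x' where "x' = complex_of_real x"
  define m where "m = order x' p"
  have m2: "2 \<le> m" using m by (simp add: m_def x'_def)
  obtain q where q: "p = [:-x', 1:] ^ m * q" "\<not> [:-x', 1:] dvd q"
    using order_decomp[OF p, of x'] unfolding m_def by blast
  then have qx: "poly q x' \<noteq> 0" by (simp add: poly_eq_0_iff_dvd)
  \<comment> \<open>\<open>F\<close> will be the quotient of \<open>poly p z / z ^ n\<close> by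
    \<open>poly d z / z ^ n'\<close>. Wherever \<open>F z\<close> is real,
    \<open>s = - Re (F z)\<close> solves the equation, so a non-real \<open>z\<close> near
    \<open>x'\<close> with \<open>F z\<close> real is sought.\<close>
  define G where "G z = poly q z * z ^ n' / (z ^ n * poly d z)" for z
  define F where "F z = (z - x') ^ m * G z" for z
  have x'0: "x' \<noteq> 0" and dx: "poly d x' \<noteq> 0" using x d by (auto simp: x'_def)
  have "isCont (poly d) x'" by simp
  then have "eventually (\<lambda>z. poly d z \<noteq> 0) (nhds x')"
    using dx by (auto simp: isCont_def tendsto_imp_eventually_ne eventually_nhds_conv_at)
  moreover have "eventually (\<lambda>z. z \<noteq> 0) (nhds x')"
    using x'0 by (rule t1_space_nhds)
  ultimately have "eventually (\<lambda>z. poly d z \<noteq> 0 \<and> z \<noteq> 0) (nhds x')" by (rule eventually_conj)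
  then obtain \<rho> where \<rho>: "\<rho> > 0" "\<And>z. dist z x' < \<rho> \<Longrightarrow> poly d z \<noteq> 0 \<and> z \<noteq> 0"
    unfolding eventually_nhds_metric by blast
  have contG: "continuous_on (ball x' \<rho>) G"
    unfolding G_def using \<rho>(2) by (intro continuous_intros) (auto simp: dist_commute)
  then have isG: "isCont G x'" using \<rho>(1) by (simp add: continuous_on_eq_continuous_at)
  have G0: "G x' \<noteq> 0" using qx x'0 dx by (simp add: G_def)
  have "isCont F x'" unfolding F_def using isG by (intro continuous_intros)
  moreover have "F x' = 0" using m2 by (simp add: F_def)
  ultimately have "eventually (\<lambda>z. cmod (F z) < \<delta>) (nhds x')"
    using \<delta> tendstoD[of F 0 "at x'" \<delta>] by (auto simp: isCont_def eventually_nhds_conv_at)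
  then obtain \<rho>' where \<rho>': "\<rho>' > 0" "\<And>z. dist z x' < \<rho>' \<Longrightarrow> cmod (F z) < \<delta>"
    unfolding eventually_nhds_metric by blast
  \<comment> \<open>With \<open>m * \<theta>1\<close> equal to \<open>pi / 3\<close> or
    \<open>pi / 2\<close>, at least one choice rotates the non-zero number \<open>G x'\<close> off
    the real axis.\<close>
  obtain \<theta>1 :: real where \<theta>1: "0 < \<theta>1" "\<theta>1 < pi / m" "Im (cis (m * \<theta>1) * G x') \<noteq> 0"
  proof -
    have "Im (cis (pi / 3) * G x') \<noteq> 0 \<or> Im (cis (pi / 2) * G x') \<noteq> 0"
    proof (rule ccontr)
      assume "\<not> ?thesis"
      then have "Re (G x') = 0" "sqrt 3 / 2 * Re (G x') + Im (G x') / 2 = 0"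
        by (auto simp: sin_60 cos_60)
      then show False using G0 by (simp add: complex_eq_iff)
    qed
    moreover have "real m * (pi / (3 * m)) = pi / 3" "real m * (pi / (2 * m)) = pi / 2"
      using m2 by auto
    moreover have "0 < pi / (3 * m)" "pi / (3 * m) < pi / m" "0 < pi / (2 * m)" "pi / (2 * m) < pi / m"
      using m2 by (auto simp: field_simps)
    ultimately show ?thesis using that by metis
  qed
  \<comment> \<open>Advancing by \<open>pi / m\<close> reverses the sign of
    \<open>cis (m * \<theta>)\<close>. Because \<open>m \<ge> 2\<close>, the arc still ends before
    the angle \<open>pi\<close>.\<close>
  define \<theta>2 :: real where "\<theta>2 = \<theta>1 + pi / m"
  have "\<theta>2 < pi"
  proof -
    have "\<theta>2 < 2 * (pi / m)" using \<theta>1 by (simp add: \<theta>2_def)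
    also have "\<dots> \<le> pi" using m2 by (simp add: field_simps)
    finally show ?thesis .
  qed
  have neg: "cis (m * \<theta>2) = - cis (m * \<theta>1)"
  proof -
    have "real m * \<theta>2 = m * \<theta>1 + pi" using m2 by (simp add: \<theta>2_def field_simps)
    then show ?thesis by (simp add: cis_mult[symmetric])
  qed
  \<comment> \<open>For positive \<open>s\<close> this is, up to the factor \<open>s ^ m\<close>,
    the imaginary part of \<open>F\<close> at distance \<open>s\<close> and angle \<theta> from
    \<open>x'\<close>.\<close>
  define u where "u s \<theta> = Im (cis (m * \<theta>) * G (x' + of_real s * cis \<theta>))" for s \<theta> :: real
  have lim: "((\<lambda>s. u s \<theta>) \<longlongrightarrow> Im (cis (m * \<theta>) * G x')) (at_right 0)" for \<theta> :: real
  proof -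
    have "((\<lambda>s. x' + of_real s * cis \<theta>) \<longlongrightarrow> x' + of_real 0 * cis \<theta>) (at_right 0)"
      by (intro tendsto_intros)
    then have "((\<lambda>s. G (x' + of_real s * cis \<theta>)) \<longlongrightarrow> G x') (at_right 0)"
      using isCont_tendsto_compose[OF isG] by simp
    then show ?thesis unfolding u_def by (intro tendsto_intros)
  qed
  define v where "v = Im (cis (m * \<theta>1) * G x')"
  have "((\<lambda>s. u s \<theta>1 * u s \<theta>2) \<longlongrightarrow> v * (- v)) (at_right 0)"
    using tendsto_mult[OF lim[of \<theta>1] lim[of \<theta>2]] by (simp add: neg v_def)
  moreover have "v \<noteq> 0" unfolding v_def by (rule \<theta>1(3))
  then have "v * (- v) < 0" by (simp add: zero_less_mult_iff) linarith
  ultimately have "eventually (\<lambda>s. u s \<theta>1 * u s \<theta>2 < 0) (at_right 0)"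
    by (rule order_tendstoD)
  moreover have "eventually (\<lambda>s. s < min \<rho> \<rho>') (at_right 0)"
    using \<rho>(1) \<rho>'(1) by (intro eventually_at_rightI[of 0 "min \<rho> \<rho>'"]) auto
  moreover have "eventually (\<lambda>s::real. s > 0) (at_right 0)" by (simp add: eventually_at_right_less)
  ultimately have "eventually (\<lambda>s. u s \<theta>1 * u s \<theta>2 < 0 \<and> s < min \<rho> \<rho>' \<and> s > 0) (at_right 0)"
    by (intro eventually_conj)
  then obtain s where s: "u s \<theta>1 * u s \<theta>2 < 0" "s < \<rho>" "s < \<rho>'" "s > 0"
    using eventually_happens[of _ "at_right (0::real)"] by fastforce
  have dist: "dist (x' + of_real s * cis \<theta>) x' = s" for \<theta> :: real
    using s(4) by (simp add: dist_norm norm_mult)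
  have cu: "continuous_on {\<theta>1..\<theta>2} (u s)"
    unfolding u_def using s dist
    by (intro continuous_intros continuous_on_compose2[OF contG]) (auto simp: dist_commute)
  obtain \<theta> :: real where \<theta>: "\<theta>1 \<le> \<theta>" "\<theta> \<le> \<theta>2" "u s \<theta> = 0"
  proof (cases "u s \<theta>1 < 0")
    case True
    then have "u s \<theta>1 \<le> 0" "0 \<le> u s \<theta>2" using s(1) by (auto simp: mult_less_0_iff)
    then show ?thesis using IVT'[of "u s" \<theta>1 0 \<theta>2] cu that m2 by (auto simp: \<theta>2_def)
  next
    case False
    then have "0 \<le> u s \<theta>1" "u s \<theta>2 \<le> 0" using s(1) by (auto simp: mult_less_0_iff)
    then show ?thesis using IVT2'[of "u s" \<theta>2 0 \<theta>1] cu that m2 by (auto simp: \<theta>2_def)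
  qed
  define z where "z = x' + of_real s * cis \<theta>"
  have z: "poly d z \<noteq> 0" "z \<noteq> 0" "cmod (F z) < \<delta>"
    using \<rho>(2) \<rho>'(2) dist s unfolding z_def by auto
  have "Im z = s * sin \<theta>" by (simp add: z_def x'_def)
  moreover have "sin \<theta> > 0" using \<theta> \<theta>1 \<open>\<theta>2 < pi\<close> by (intro sin_gt_zero) auto
  ultimately have "Im z \<noteq> 0" using s(4) by simp
  have "F z = of_real (s ^ m) * (cis (m * \<theta>) * G z)"
    by (simp add: F_def z_def power_mult_distrib Complex.DeMoivre)
  moreover have "Im (cis (m * \<theta>) * G z) = 0" using \<theta>(3) by (simp add: u_def z_def)
  ultimately have "Im (F z) = 0" by (simp only: Im_complex_of_real Re_complex_of_real times_complex.sel)
  define t where "t = - Re (F z)"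
  have "F z = - of_real t" using \<open>Im (F z) = 0\<close> by (simp add: t_def complex_eq_iff)
  moreover have "\<bar>t\<bar> < \<delta>" using z(3) abs_Re_le_cmod[of "F z"] by (simp add: t_def)
  moreover have "poly p z / z ^ n = F z * (poly d z / z ^ n')"
    using z by (simp add: F_def G_def q field_simps)
  ultimately have "poly p z / z ^ n + of_real t * (poly d z / z ^ n') = 0" by simp
  then show ?thesis using z \<open>Im z \<noteq> 0\<close> \<open>\<bar>t\<bar> < \<delta>\<close> by blast
qed

section \<open>The determinant as a Laurent polynomial\<close>

lemma poly_det:
  fixes A :: "complex poly ^ 'n ^ 'n"
  shows "poly (det A) z = det (\<chi> i j. poly (A $ i $ j) z)"
  by (simp add: det_def poly_sum poly_prod poly_of_int)

text \<open>Multiplying every row by \<open>z ^ B\<close>, with \<open>B\<close> at least every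
  absolute gain, clears all negative powers.\<close>

lemma det_gain_laplacian_poly:
  fixes N :: "('v::finite, 'e) network"
  assumes "finite (edges N)"
  shows "\<exists>p n. \<forall>z. z \<noteq> 0 \<longrightarrow> det (gain_laplacian N k c z) = poly p z / z ^ n"
proof -
  define B where "B = nat (\<Sum>d\<in>darts N. \<bar>dart_gain k d\<bar>)"
  have B: "\<bar>dart_gain k d\<bar> \<le> int B" if "d \<in> darts N" for d
  proof -
    have "\<bar>dart_gain k d\<bar> \<le> (\<Sum>d\<in>darts N. \<bar>dart_gain k d\<bar>)"
      using that finite_darts[OF assms] by (intro member_le_sum) auto
    then show ?thesis by (simp add: B_def)
  qed
  define A :: "complex poly ^ 'v ^ 'v" where "A = (\<chi> u v. \<Sum>d | d \<in> darts N \<and> dart_tail N d = u.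
    smult (of_real (c (fst d))) ((if u = v then monom 1 B else 0) -
      (if dart_head N d = v then monom 1 (nat (int B + dart_gain k d)) else 0)))"
  have A: "poly (A $ u $ v) z = z ^ B * gain_laplacian N k c z $ u $ v" if z: "z \<noteq> 0" for u v z
  proof -
    have "z ^ nat (int B + dart_gain k d) = z ^ B * z powi dart_gain k d" if "d \<in> darts N" for d
    proof -
      have "z ^ nat (int B + dart_gain k d) = z powi (int B + dart_gain k d)"
        using B[OF that] by (simp add: power_int_def)
      then show ?thesis using z by (simp add: power_int_add)
    qed
    then show ?thesis
      unfolding A_def gain_laplacian_def vec_lambda_beta poly_sum sum_distrib_left
      by (intro sum.cong) (auto simp: poly_monom algebra_simps)
  qed
  have "det (gain_laplacian N k c z) = poly (det A) z / z ^ (B * CARD('v))" if z: "z \<noteq> 0" for z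
  proof -
    have "(\<chi> u v. poly (A $ u $ v) z) = (\<chi> u. z ^ B *s gain_laplacian N k c z $ u)"
      using A[OF z] by (simp add: vec_eq_iff)
    then have "poly (det A) z = z ^ (B * CARD('v)) * det (gain_laplacian N k c z)"
      by (simp only: poly_det det_rows_mul vec_nth_inverse) (simp add: power_mult)
    then show ?thesis using z by simp
  qed
  then show ?thesis by blast
qed

text \<open>At a multiple root, vary the conductance of a common gradient edge: the slope in
  \<open>s\<close> is non-zero at \<open>x\<close>, so some \<open>s\<close> smaller than that
  conductance produces a non-real root. The perturbed conductances are still positive, contradicting
  \<open>root_positive\<close>.\<close>

lemma (in annular_network) root_simple:
  assumes c: "positive_on_edges N c" and p: "p \<noteq> 0"
    and det: "\<And>z. z \<noteq> 0 \<Longrightarrow> det (gain_laplacian N k c z) = poly p z / z ^ n"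
    and x: "x \<noteq> 0" "x \<noteq> 1" "poly p x = 0"
  shows "order x p = 1"
proof (rule ccontr)
  assume "order x p \<noteq> 1"
  moreover have "order x p \<noteq> 0" using p x(3) order_root by blast
  ultimately have ord: "2 \<le> order x p" by simp
  have det0: "det (gain_laplacian N k c x) = 0" using det x by simp
  define r where "r = cmod x"
  have x_eq: "x = of_real r" using root_positive[OF c x(1) det0] by (simp add: r_def)
  have "r > 0" using x(1) by (simp add: r_def)
  moreover have "r \<noteq> 1" using x(2) x_eq by auto
  ultimately have r: "r > 0" "r \<noteq> 1" by auto
  obtain f where f: "gain_laplacian N k c (of_real r) *v f = 0" "f \<noteq> 0"
    using det0 det_eq_0_iff_ker unfolding x_eq by blast
  obtain g where g: "gain_laplacian N k c (1 / of_real r) *v g = 0" "g \<noteq> 0"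
  proof -
    have "det (gain_laplacian N k c (1 / of_real r)) = 0"
      using det0 det_gain_laplacian_inverse[OF fin x(1), of k c] unfolding x_eq by simp
    then show ?thesis using that det_eq_0_iff_ker by blast
  qed
  obtain e where e: "e \<in> edges N" "f $ tail N e \<noteq> of_real r powi k e * f $ head N e"
    "g $ tail N e \<noteq> of_real r powi (- k e) * g $ head N e"
    using common_gradient_edge[OF c r f g] by blast
  have "cmod (of_real r) \<noteq> 1" using r by simp
  then have pert: "det (gain_laplacian N k (c(e := c e + 1)) x) \<noteq> 0"
    using det_perturbed_nonzero[OF c _ _ f g(1) e, of 1] r unfolding x_eq by simp
  obtain d' n' where d': "\<And>z. z \<noteq> 0 \<Longrightarrow> det (gain_laplacian N k (c(e := c e + 1)) z) = poly d' z / z ^ n'"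
    using det_gain_laplacian_poly[OF fin] by metis
  \<comment> \<open>Numerator of the slope over the common denominator
    \<open>z ^ (n + n')\<close>.\<close>
  define d where "d = d' * monom 1 n - p * monom 1 n'"
  have d: "poly d z / z ^ (n + n') =
      det (gain_laplacian N k (c(e := c e + 1)) z) - det (gain_laplacian N k c z)" if "z \<noteq> 0" for z
    unfolding det[OF that] d'[OF that] using that by (simp add: d_def poly_monom power_add field_simps)
  have "poly d x \<noteq> 0" using d[OF x(1)] pert det0 by auto
  then have "poly d (of_real r) \<noteq> 0" unfolding x_eq .
  moreover have "c e > 0" using c e by (simp add: positive_on_edges_def)
  ultimately obtain z s where zs: "z \<noteq> 0" "Im z \<noteq> 0" "\<bar>s\<bar> < c e"
    "poly p z / z ^ n + of_real s * (poly d z / z ^ (n + n')) = 0"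
    using real_values_near_multiple_zero[OF p ord[unfolded x_eq], of d "c e" n "n + n'"] r(1) by auto
  have "det (gain_laplacian N k (c(e := c e + s)) z) =
      det (gain_laplacian N k c z) + of_real s * (poly d z / z ^ (n + n'))"
    unfolding d[OF zs(1)] by (rule det_gain_laplacian_affine[OF fin e(1) zs(1)])
  also have "\<dots> = 0" unfolding det[OF zs(1)] by (rule zs(4))
  finally have "det (gain_laplacian N k (c(e := c e + s)) z) = 0" .
  moreover have "positive_on_edges N (c(e := c e + s))"
    using c zs(3) by (auto simp: positive_on_edges_def)
  ultimately have "z = of_real (cmod z)" using root_positive zs(1) by blast
  then have "Im z = 0" by (metis Im_complex_of_real)
  then show False using zs(2) by simp
qed

section \<open>The order of the root 1\<close>

lemma tendsto_det:
  fixes A :: "'b \<Rightarrow> complex ^ 'n ^ 'n"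
  assumes "\<And>i j. ((\<lambda>x. A x $ i $ j) \<longlongrightarrow> B $ i $ j) F"
  shows "((\<lambda>x. det (A x)) \<longlongrightarrow> det B) F"
  unfolding det_def by (intro tendsto_intros assms)

text \<open>On the unit circle transports are isometries, so the errors of the single steps add
  up.\<close>

lemma walk_transport_bound:
  fixes g :: "complex ^ 'v::finite"
  assumes z: "cmod z = 1"
    and b: "\<And>e. e \<in> edges N \<Longrightarrow> cmod (g $ tail N e - z powi k e * g $ head N e) \<le> b"
  shows "walk N u ds v \<Longrightarrow> cmod (g $ u - z powi gain k ds * g $ v) \<le> real (length ds) * b"
proof (induction ds arbitrary: u)
  case (Cons d ds)
  then have d: "d \<in> darts N" "dart_tail N d = u" "walk N (dart_head N d) ds v" by auto
  have "z \<noteq> 0" using z by auto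
  have 1: "cmod (g $ u - z powi dart_gain k d * g $ dart_head N d) \<le> b"
  proof (cases "snd d")
    case True
    then show ?thesis using b[of "fst d"] d
      by (auto simp: dart_tail_def dart_head_def dart_gain_def darts_def)
  next
    case False
    define Z where "Z = z powi k (fst d)"
    have Z: "Z \<noteq> 0" "cmod Z = 1" using z \<open>z \<noteq> 0\<close> by (auto simp: Z_def norm_power_int)
    have "g $ tail N (fst d) - Z * g $ head N (fst d) = - Z * (g $ u - inverse Z * g $ dart_head N d)"
      using False d(2) Z(1) by (simp add: dart_tail_def dart_head_def field_simps)
    then have "cmod (g $ u - inverse Z * g $ dart_head N d) =
        cmod (g $ tail N (fst d) - Z * g $ head N (fst d))"
      using Z(2) by (simp add: norm_mult)
    also have "\<dots> \<le> b" using b[of "fst d"] d(1) by (auto simp: Z_def darts_def)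
    finally show ?thesis using False by (simp add: Z_def dart_gain_def power_int_minus)
  qed
  have "g $ u - z powi gain k (d # ds) * g $ v = (g $ u - z powi dart_gain k d * g $ dart_head N d) +
      z powi dart_gain k d * (g $ dart_head N d - z powi gain k ds * g $ v)"
    using \<open>z \<noteq> 0\<close> by (simp add: power_int_add algebra_simps)
  also have "cmod \<dots> \<le> cmod (g $ u - z powi dart_gain k d * g $ dart_head N d) +
      cmod (z powi dart_gain k d * (g $ dart_head N d - z powi gain k ds * g $ v))"
    by (rule norm_triangle_ineq)
  also have "\<dots> \<le> b + real (length ds) * b"
    using 1 Cons.IH[OF d(3)] z by (intro add_mono) (simp_all add: norm_mult norm_power_int)
  finally show ?case by (simp add: algebra_simps)
qed simp

text \<open>Dirichlet condition at \<open>a\<close>. The determinant is the principal minor of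
  \<open>M\<close> without row and column \<open>a\<close>.\<close>

definition grounded :: "complex ^ 'n ^ 'n \<Rightarrow> 'n::finite \<Rightarrow> complex ^ 'n ^ 'n" where
  "grounded M a = (\<chi> i. if i = a then axis a 1 else M $ i)"

lemma grounded_mult:
  "(grounded M a *v x) $ i = (if i = a then x $ a else (M *v x) $ i)"
proof -
  have "(\<Sum>j\<in>UNIV. axis a 1 $ j * x $ j) = x $ a"
    by (simp add: axis_def if_distrib[of "\<lambda>y. y * _"] cong: if_cong)
  then show ?thesis by (simp add: grounded_def matrix_vector_mult_def)
qed

text \<open>A kernel vector vanishes at \<open>a\<close> and is harmonic elsewhere, so it has no
  energy; it is then flat, and connectedness spreads the zero at \<open>a\<close>.\<close>

lemma (in annular_network) det_grounded_nonzero: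
  assumes c: "positive_on_edges N c"
  shows "det (grounded (gain_laplacian N k c 1) a) \<noteq> 0"
proof
  assume "det (grounded (gain_laplacian N k c 1) a) = 0"
  then obtain y where y: "y \<noteq> 0" "grounded (gain_laplacian N k c 1) a *v y = 0"
    using det_eq_0_iff_ker by blast
  have comp: "(if i = a then y $ a else (gain_laplacian N k c 1 *v y) $ i) = 0" for i
    using y(2) unfolding grounded_mult[symmetric] by simp
  have ya: "y $ a = 0" using comp[of a] by simp
  have "(\<Sum>u\<in>UNIV. cnj (y $ u) * (gain_laplacian N k c 1 *v y) $ u) = 0"
  proof (rule sum.neutral, rule ballI)
    fix u show "cnj (y $ u) * (gain_laplacian N k c 1 *v y) $ u = 0"
      using comp[of u] ya by (cases "u = a") auto
  qed
  then have "complex_of_real (\<Sum>e\<in>edges N. c e * (cmod (y $ tail N e - 1 powi k e * y $ head N e))\<^sup>2) = 0"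
    using energy_unit_circle[OF fin, of 1 y k c] by simp
  then have "(\<Sum>e\<in>edges N. c e * (cmod (y $ tail N e - 1 powi k e * y $ head N e))\<^sup>2) = 0"
    by (simp only: of_real_eq_0_iff)
  then have flat: "y $ tail N e = 1 powi k e * y $ head N e" if "e \<in> edges N" for e
    using energy_eq_0[OF fin c] that by blast
  have "y $ u = 0" for u
  proof -
    obtain ds where "walk N u ds a" using conn by blast
    then show ?thesis using transported_closed[of 1 y, OF _ flat] ya by simp
  qed
  then show False using y(1) by (simp add: vec_eq_iff)
qed

text \<open>Cramer's rule writes the determinant as a grounded determinant times an energy.\<close>

lemma (in annular_network) det_unit_circle_lower_bound:
  assumes c: "positive_on_edges N c"
  obtains C where "C > 0" "\<And>z. cmod z = 1 \<Longrightarrow> det (grounded (gain_laplacian N k c z) a) \<noteq> 0 \<Longrightarrow>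
    C * (cmod (z - 1))\<^sup>2 * cmod (det (grounded (gain_laplacian N k c (1 / z)) a)) \<le>
      cmod (det (gain_laplacian N k c z))"
proof -
  obtain ds where ds: "walk N a ds a" "gain k ds = 1" using closed_walk_gain_one by blast
  define l where "l = real (length ds)"
  \<comment> \<open>As \<open>K\<close> bounds every \<open>1 / c e\<close>, each edge gradient is
    at most \<open>sqrt (K * E)\<close>, where \<open>E\<close> is the energy. Around the walk
    \<open>ds\<close> of gain 1 this gives \<open>cmod (1 - z) \<le> l * sqrt (K * E)\<close>; the
    summand 1 in \<open>C\<close> keeps the denominator positive.\<close>
  define K where "K = (\<Sum>e\<in>edges N. 1 / c e)"
  define C where "C = 1 / (l\<^sup>2 * K + 1)"
  have c_pos: "c e > 0" if "e \<in> edges N" for e using c that by (simp add: positive_on_edges_def)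
  have "K \<ge> 0" unfolding K_def using c_pos by (intro sum_nonneg) (simp add: less_imp_le)
  then have C: "C > 0" by (simp add: C_def add_nonneg_pos)
  have "C * (cmod (z - 1))\<^sup>2 * cmod (det (grounded (gain_laplacian N k c (1 / z)) a)) \<le>
      cmod (det (gain_laplacian N k c z))"
    if z: "cmod z = 1" "det (grounded (gain_laplacian N k c z) a) \<noteq> 0" for z
  proof -
    have "z \<noteq> 0" using z by auto
    define G where "G = grounded (gain_laplacian N k c z) a"
    have "invertible G" using z(2) unfolding G_def by (subst invertible_det_nz)
    then obtain G' where "G ** G' = mat 1" unfolding invertible_def by blast
    \<comment> \<open>\<open>g\<close> has value 1 at \<open>a\<close> and is harmonic elsewhere.
      The energy identity then shows that its Laplacian at \<open>a\<close> is its energy.\<close>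
    define g where "g = G' *v axis a 1"
    have "G *v g = axis a 1"
      unfolding g_def matrix_vector_mul_assoc \<open>G ** G' = mat 1\<close> by simp
    then have comp: "(if i = a then g $ a else (gain_laplacian N k c z *v g) $ i) = axis a 1 $ i" for i
      unfolding grounded_mult[symmetric] G_def by simp
    have ga: "g $ a = 1" using comp[of a] by simp
    define s where "s = (gain_laplacian N k c z *v g) $ a"
    have Mg: "gain_laplacian N k c z *v g = s *s axis a 1"
    proof (subst vec_eq_iff, rule allI)
      fix i show "(gain_laplacian N k c z *v g) $ i = (s *s axis a 1) $ i"
        using comp[of i] by (cases "i = a") (auto simp: s_def axis_def)
    qed
    define E where "E = (\<Sum>e\<in>edges N. c e * (cmod (g $ tail N e - z powi k e * g $ head N e))\<^sup>2)"
    have "of_real E = (\<Sum>u\<in>UNIV. cnj (g $ u) * (gain_laplacian N k c z *v g) $ u)"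
      unfolding energy_unit_circle[OF fin z(1)] E_def ..
    also have "\<dots> = s"
      unfolding Mg by (simp add: axis_def ga if_distrib[of "\<lambda>y. _ * y"] cong: if_cong)
    finally have sE: "s = of_real E" ..
    have E0: "E \<ge> 0" unfolding E_def using c_pos by (intro sum_nonneg) (simp add: less_imp_le)
    have edge: "cmod (g $ tail N e - z powi k e * g $ head N e) \<le> sqrt (K * E)" if e: "e \<in> edges N" for e
    proof -
      have "c e * (cmod (g $ tail N e - z powi k e * g $ head N e))\<^sup>2 \<le> E"
        unfolding E_def using c_pos fin e by (intro member_le_sum) (auto simp: less_imp_le)
      then have "(cmod (g $ tail N e - z powi k e * g $ head N e))\<^sup>2 \<le> 1 / c e * E"
        using c_pos[OF e] by (simp add: field_simps)
      also have "\<dots> \<le> K * E"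
        unfolding K_def using E0 c_pos fin e by (intro mult_right_mono member_le_sum) (auto simp: less_imp_le)
      finally show ?thesis by (rule real_le_rsqrt)
    qed
    have "cmod (1 - z) \<le> l * sqrt (K * E)"
      using walk_transport_bound[OF z(1) edge ds(1)] ds(2) ga by (simp add: l_def)
    then have "(cmod (1 - z))\<^sup>2 \<le> (l * sqrt (K * E))\<^sup>2" by (intro power_mono) auto
    then have "(cmod (z - 1))\<^sup>2 \<le> l\<^sup>2 * K * E"
      using \<open>K \<ge> 0\<close> E0 by (simp add: power_mult_distrib norm_minus_commute)
    also have "\<dots> \<le> (l\<^sup>2 * K + 1) * E" using E0 by (simp add: distrib_right)
    finally have E: "C * (cmod (z - 1))\<^sup>2 \<le> E"
      using \<open>K \<ge> 0\<close> by (simp add: C_def divide_simps add_nonneg_pos mult.commute)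
    define A where "A = gain_laplacian N k c (1 / z)"
    \<comment> \<open>As \<open>A\<close> is the transposed matrix, combining its rows with
      coefficients \<open>g\<close> gives the Laplacian of \<open>g\<close>, which is supported at
      \<open>a\<close>. Cramer's rule puts it into row \<open>a\<close>, with factor
      \<open>g $ a = 1\<close>.\<close>
    have sum: "(\<Sum>i\<in>UNIV. g $ i *s row i A) = s *s axis a 1"
      unfolding Mg[symmetric] A_def gain_laplacian_inverse[OF fin \<open>z \<noteq> 0\<close>]
      by (simp add: vec_eq_iff matrix_vector_mult_def row_def transpose_def mult.commute)
    have "det A = g $ a * det A" using ga by simp
    also have "\<dots> = det (\<chi> i. if i = a then \<Sum>i\<in>UNIV. g $ i *s row i A else row i A)"
      by (rule cramer_lemma_transpose[symmetric])
    also have "\<dots> = det (\<chi> i. if i = a then s *s axis a 1 else row i A)" unfolding sum ..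
    also have "\<dots> = s * det (\<chi> i. if i = a then axis a 1 else row i A)" by (rule det_row_mul)
    also have "(\<chi> i. if i = a then axis a 1 else row i A) = grounded A a"
      by (simp add: grounded_def row_def vec_eq_iff)
    finally have "det (gain_laplacian N k c z) = s * det (grounded A a)"
      using det_gain_laplacian_inverse[OF fin \<open>z \<noteq> 0\<close>] by (simp add: A_def)
    then show ?thesis
      using E E0 by (simp add: norm_mult sE A_def mult_right_mono)
  qed
  then show ?thesis using that C by blast
qed

text \<open>Constants lie in the kernel at 1, so the order is positive, and it is even by
  reciprocity. An order above 2 would violate the quadratic lower bound on the unit circle near
  1.\<close>

lemma (in annular_network) root_one_double:
  assumes c: "positive_on_edges N c" and p: "p \<noteq> 0"
    and det: "\<And>z. z \<noteq> 0 \<Longrightarrow> det (gain_laplacian N k c z) = poly p z / z ^ n"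
  shows "order 1 p = 2"
proof -
  define m where "m = order 1 p"
  have "gain_laplacian N k c 1 *v 1 = 0"
    by (simp add: vec_eq_iff gain_laplacian_mult)
  then have "det (gain_laplacian N k c 1) = 0"
    unfolding det_eq_0_iff_ker by (intro exI[of _ 1]) (simp add: vec_eq_iff)
  then have "poly p 1 = 0" using det[of 1] by simp
  then have "m \<noteq> 0" using p order_root unfolding m_def by blast
  moreover have "even m" unfolding m_def
    using root_order_even[OF p, of "\<lambda>z. det (gain_laplacian N k c z)" n] det
    by (simp add: det_gain_laplacian_inverse fin)
  moreover have "m \<le> 2"
  proof (rule ccontr)
    assume "\<not> m \<le> 2"
    \<comment> \<open>After division by a square the exponent \<open>Suc j\<close> remains, which is
      positive, so that this power of \<open>cis t - 1\<close> still tends to 0.\<close>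
    define j where "j = m - 3"
    have j: "m = Suc j + 2" using \<open>\<not> m \<le> 2\<close> by (simp add: j_def)
    obtain q where q: "p = [:-1, 1:] ^ m * q"
      using order_1[of 1 p] unfolding m_def by (auto elim: dvdE)
    obtain C where C: "C > 0" "\<And>z. cmod z = 1 \<Longrightarrow> det (grounded (gain_laplacian N k c z) a) \<noteq> 0 \<Longrightarrow>
      C * (cmod (z - 1))\<^sup>2 * cmod (det (grounded (gain_laplacian N k c (1 / z)) a)) \<le>
        cmod (det (gain_laplacian N k c z))"
      using det_unit_circle_lower_bound[OF c] by blast
    define H where "H z = det (grounded (gain_laplacian N k c z) a)" for z
    have H1: "H 1 \<noteq> 0" using det_grounded_nonzero[OF c] by (simp add: H_def)
    have limH: "((\<lambda>t. H (Z t)) \<longlongrightarrow> H 1) (at_right 0)"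
      if "(Z \<longlongrightarrow> 1) (at_right (0::real))" for Z
      unfolding H_def
    proof (rule tendsto_det)
      fix i j
      have "((\<lambda>t. gain_laplacian N k c (Z t) $ i $ j) \<longlongrightarrow> gain_laplacian N k c 1 $ i $ j) (at_right 0)"
        unfolding gain_laplacian_def vec_lambda_beta by (intro tendsto_intros that) auto
      then show "((\<lambda>t. grounded (gain_laplacian N k c (Z t)) a $ i $ j) \<longlongrightarrow>
          grounded (gain_laplacian N k c 1) a $ i $ j) (at_right 0)"
        by (cases "i = a") (simp_all add: grounded_def)
    qed
    have cis: "(cis \<longlongrightarrow> 1) (at_right (0::real))"
    proof -
      have "((\<lambda>t. cis t) \<longlongrightarrow> cis 0) (at_right (0::real))" by (intro tendsto_intros)
      then show ?thesis by simp
    qed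
    have cis': "((\<lambda>t. 1 / cis t) \<longlongrightarrow> 1) (at_right (0::real))"
    proof -
      have "((\<lambda>t. 1 / cis t) \<longlongrightarrow> 1 / 1) (at_right (0::real))" by (intro tendsto_intros cis) auto
      then show ?thesis by simp
    qed
    \<comment> \<open>\<open>L\<close> and \<open>R\<close> are the two sides of the lower bound at
      \<open>cis t\<close>, divided by \<open>(cmod (cis t - 1))\<^sup>2\<close>.\<close>
    define L where "L t = C * cmod (H (1 / cis t))" for t
    define R where "R t = cmod (cis t - 1) ^ Suc j * cmod (poly q (cis t))" for t
    have "(L \<longlongrightarrow> C * cmod (H 1)) (at_right 0)"
      unfolding L_def by (intro tendsto_intros limH cis')
    moreover have "(R \<longlongrightarrow> cmod (1 - 1) ^ Suc j * cmod (poly q 1)) (at_right 0)"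
      unfolding R_def by (intro tendsto_intros cis)
    moreover have "eventually (\<lambda>t. L t \<le> R t) (at_right 0)"
    proof -
      have "eventually (\<lambda>t. H (cis t) \<noteq> 0) (at_right 0)"
        using limH[OF cis] H1 by (rule tendsto_imp_eventually_ne)
      moreover have "eventually (\<lambda>t::real. t \<in> {0<..<pi}) (at_right 0)"
        by (intro eventually_at_rightI[of 0 pi]) auto
      ultimately show ?thesis
      proof eventually_elim
        case (elim t)
        have ne: "cis t \<noteq> 1" using elim(2) sin_gt_zero[of t] by (auto simp: complex_eq_iff)
        have "C * (cmod (cis t - 1))\<^sup>2 * cmod (H (1 / cis t)) \<le> cmod (poly p (cis t) / cis t ^ n)"
          using C(2)[of "cis t"] elim(1) det[of "cis t"] by (simp add: H_def)
        also have "\<dots> = cmod (cis t - 1) ^ m * cmod (poly q (cis t))"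
          by (simp add: q norm_divide norm_mult norm_power)
        also have "\<dots> = (cmod (cis t - 1))\<^sup>2 * R t" by (simp add: j R_def power_add power2_eq_square)
        finally have "(cmod (cis t - 1))\<^sup>2 * L t \<le> (cmod (cis t - 1))\<^sup>2 * R t"
          by (simp add: L_def mult_ac)
        then show ?case using ne by simp
      qed
    qed
    ultimately have "C * cmod (H 1) \<le> cmod (1 - 1) ^ Suc j * cmod (poly q 1)"
      by (intro tendsto_le[of "at_right (0::real)" R _ L]) auto
    then show False using C(1) H1 by (simp add: mult_le_0_iff)
  qed
  ultimately have "m = 2" by presburger
  then show ?thesis by (simp add: m_def)
qed

lemma (in annular_network) det_gain_laplacian_roots:
  assumes c: "positive_on_edges N c"
    and det: "\<And>z. z \<noteq> 0 \<Longrightarrow> det (gain_laplacian N k c z) = poly p z / z ^ n"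
  shows "p \<noteq> 0 \<and> (\<forall>x. x \<noteq> 0 \<and> poly p x = 0 \<longrightarrow> x \<in> \<real> \<and> Re x > 0) \<and>
    order 1 p = 2 \<and> (\<forall>x. x \<noteq> 0 \<and> x \<noteq> 1 \<and> poly p x = 0 \<longrightarrow> order x p = 1)"
proof (intro conjI allI impI)
  show p: "p \<noteq> 0"
  proof
    assume "p = 0"
    \<comment> \<open>Any non-zero point that is not positive would serve as a witness, since roots
      are positive.\<close>
    then have "det (gain_laplacian N k c (-1)) = 0" using det[of "-1"] by simp
    then have "-1 = complex_of_real (cmod (-1))" using root_positive[OF c, of "-1"] by simp
    then show False by simp
  qed
  show "order 1 p = 2" by (rule root_one_double[OF c p det])
  fix x
  show "order x p = 1" if "x \<noteq> 0 \<and> x \<noteq> 1 \<and> poly p x = 0"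
    using root_simple[OF c p det] that by blast
  assume x: "x \<noteq> 0 \<and> poly p x = 0"
  then have "x = of_real (cmod x)" using root_positive[OF c] det by simp
  moreover have "cmod x > 0" using x by simp
  ultimately show "x \<in> \<real>" "Re x > 0" by (metis Reals_of_real, metis Re_complex_of_real)
qed

section \<open>Lifting the drawing to the strip\<close>

text \<open>With \<open>Im\<close> as abscissa and \<open>M - Re\<close> as height, the four
  endpoints lie interlaced on the bottom side of a box containing both paths, which is the situation
  of the Fashoda theorem.\<close>

lemma paths_in_half_plane_cross:
  fixes g h :: "real \<Rightarrow> complex"
  assumes g: "path g" "path_image g \<subseteq> {x. Re x \<le> M}" and h: "path h" "path_image h \<subseteq> {x. Re x \<le> M}"
    and ends: "Re (pathstart g) = M" "Re (pathfinish g) = M" "Re (pathstart h) = M" "Re (pathfinish h) = M"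
    and order: "Im (pathstart g) < Im (pathstart h)" "Im (pathstart h) < Im (pathfinish g)"
      "Im (pathfinish g) < Im (pathfinish h)"
  shows "path_image g \<inter> path_image h \<noteq> {}"
proof -
  define \<phi> :: "complex \<Rightarrow> real ^ 2" where "\<phi> x = (\<chi> i. if i = 1 then Im x else M - Re x)" for x
  have \<phi>: "\<phi> x $ 1 = Im x" "\<phi> x $ 2 = M - Re x" for x by (simp_all add: \<phi>_def)
  have cont: "continuous_on A \<phi>" for A
  proof -
    have "continuous_on A (\<lambda>x. if i = 1 then Im x else M - Re x)" for i :: 2
      by (cases "i = 1") (auto intro!: continuous_intros)
    then show ?thesis unfolding \<phi>_def by (intro continuous_on_vec_lambda)
  qed
  have inj: "x = y" if "\<phi> x = \<phi> y" for x y
    using arg_cong[OF that, of "\<lambda>v. v $ 1"] arg_cong[OF that, of "\<lambda>v. v $ 2"]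
    by (simp add: \<phi> complex_eq_iff)
  have "bounded (path_image g \<union> path_image h)"
    using g h by (simp add: bounded_path_image)
  then obtain B where B: "\<And>x. x \<in> path_image g \<union> path_image h \<Longrightarrow> cmod x \<le> B"
    by (auto simp: bounded_iff)
  define lo hi :: "real ^ 2" where "lo = (\<chi> i. if i = 1 then - B else 0)"
    and "hi = (\<chi> i. if i = 1 then B else M + B)"
  have box: "\<phi> x \<in> cbox lo hi" if "x \<in> path_image g \<union> path_image h" for x
  proof -
    have "Re x \<le> M" "\<bar>Im x\<bar> \<le> B" "\<bar>Re x\<bar> \<le> B"
      using that g(2) h(2) B[OF that] abs_Im_le_cmod[of x] abs_Re_le_cmod[of x] by auto
    then show ?thesis by (auto simp: mem_box_cart forall_2 \<phi> lo_def hi_def)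
  qed
  have "pathstart (\<phi> \<circ> p) = \<phi> (pathstart p)" "pathfinish (\<phi> \<circ> p) = \<phi> (pathfinish p)" for p
    by (simp_all add: pathstart_def pathfinish_def)
  note se = this
  obtain z where "z \<in> path_image (\<phi> \<circ> g)" "z \<in> path_image (\<phi> \<circ> h)"
  proof (rule fashoda_interlace[of "\<phi> \<circ> g" "\<phi> \<circ> h" lo hi])
    show "path (\<phi> \<circ> g)" "path (\<phi> \<circ> h)" using g h cont by (auto intro: path_continuous_image)
    show "path_image (\<phi> \<circ> g) \<subseteq> cbox lo hi" "path_image (\<phi> \<circ> h) \<subseteq> cbox lo hi"
      using box by (auto simp: path_image_compose)
  qed (use ends order in \<open>auto simp: se \<phi> lo_def\<close>)
  then obtain x y where "x \<in> path_image g" "y \<in> path_image h" "\<phi> x = \<phi> y"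
    by (auto simp: path_image_compose)
  then show ?thesis using inj by blast
qed

section \<open>The covering of the annulus by a vertical strip under \<open>exp\<close>\<close>

definition deck :: "int \<Rightarrow> complex" where
  "deck n = of_int n * (2 * of_real pi * \<i>)"

lemma deck_simps: "deck 0 = 0" "deck (m + n) = deck m + deck n" "deck (- n) = - deck n"
  "Re (deck n) = 0" "Im (deck n) = 2 * pi * of_int n"
  by (simp_all add: deck_def algebra_simps)

lemma exp_add_deck: "exp (x + deck n) = exp x"
  by (simp add: deck_def exp_add exp_integer_2pi[OF Ints_of_int] mult.commute mult.left_commute)

lemma exp_eq_deck: "exp x = exp y \<longleftrightarrow> (\<exists>n. x = y + deck n)"
  unfolding exp_eq deck_def by (simp add: mult.commute mult.left_commute)

lemma deck_inject: "deck m = deck n \<longleftrightarrow> m = n"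
  by (simp add: deck_def)

lemma exp_in_annulus_iff:
  assumes "0 < r" "0 < R"
  shows "exp x \<in> annulus r R \<longleftrightarrow> ln r \<le> Re x \<and> Re x \<le> ln R"
  using assms by (simp add: annulus_def ln_ge_iff) (metis exp_le_cancel_iff exp_ln)

text \<open>The strip over the annulus is convex, so the lifts can be interpolated linearly. Both
  lifts have the same period \<open>deck n\<close>, so every intermediate curve becomes closed under
  \<open>exp\<close>.\<close>

lemma homotopic_loops_exp:
  assumes r: "0 < r" "0 < R"
    and p: "path p" "\<And>t. t \<in> {0..1} \<Longrightarrow> exp (p t) = P t" "\<And>t. t \<in> {0..1} \<Longrightarrow> P t \<in> annulus r R"
    and q: "path q" "\<And>t. t \<in> {0..1} \<Longrightarrow> exp (q t) = Q t" "\<And>t. t \<in> {0..1} \<Longrightarrow> Q t \<in> annulus r R"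
    and per: "pathfinish p = pathstart p + deck n" "pathfinish q = pathstart q + deck n"
  shows "homotopic_loops (annulus r R) P Q"
proof -
  define h where "h = (\<lambda>x. exp (of_real (1 - fst x) * p (snd x) + of_real (fst x) * q (snd x)))"
  have "continuous_on ({0..1} \<times> {0..1}) h"
    unfolding h_def
    by (intro continuous_intros continuous_on_compose2[OF p(1)[unfolded path_def]]
        continuous_on_compose2[OF q(1)[unfolded path_def]]) auto
  moreover have "h \<in> {0..1} \<times> {0..1} \<rightarrow> annulus r R"
  proof
    fix x :: "real \<times> real" assume "x \<in> {0..1} \<times> {0..1}"
    then obtain s t where x: "x = (s, t)" "0 \<le> s" "s \<le> 1" "t \<in> {0..1}" by (cases x) auto
    have P: "ln r \<le> Re (p t)" "Re (p t) \<le> ln R" and Q: "ln r \<le> Re (q t)" "Re (q t) \<le> ln R"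
      using p(2,3)[OF x(4)] q(2,3)[OF x(4)] exp_in_annulus_iff[OF r] by metis+
    have "(1 - s) * ln r + s * ln r \<le> (1 - s) * Re (p t) + s * Re (q t)"
      using P Q x by (intro add_mono mult_left_mono) auto
    moreover have "(1 - s) * Re (p t) + s * Re (q t) \<le> (1 - s) * ln R + s * ln R"
      using P Q x by (intro add_mono mult_left_mono) auto
    ultimately show "h x \<in> annulus r R"
      unfolding h_def exp_in_annulus_iff[OF r] x(1) by (simp add: algebra_simps)
  qed
  moreover have "pathfinish (h \<circ> Pair s) = pathstart (h \<circ> Pair s)" for s
  proof -
    have "of_real (1 - s) * p 1 + of_real s * q 1 = (of_real (1 - s) * p 0 + of_real s * q 0) + deck n"
      using per by (simp add: pathfinish_def pathstart_def algebra_simps)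
    then show ?thesis
      by (simp only: pathfinish_def pathstart_def h_def o_def fst_conv snd_conv exp_add_deck)
  qed
  moreover have "\<forall>t\<in>{0..1}. h (0, t) = P t" "\<forall>t\<in>{0..1}. h (1, t) = Q t"
    using p(2) q(2) by (auto simp: h_def)
  ultimately show ?thesis unfolding homotopic_loops by blast
qed

lemma circlepath_exp:
  assumes "0 < r"
  shows "exp (of_real (ln r) + of_real t * deck 1) = circlepath 0 r t"
proof -
  have "exp (complex_of_real (ln r)) = of_real r" using assms by (simp add: exp_of_real)
  then show ?thesis
    by (simp add: circlepath_def part_circlepath_def linepath_def deck_def exp_add mult_ac)
qed

text \<open>A choice of logarithms for the drawing. The gain of an edge records by which deck
  translation its lift, started at the chosen lift of the tail, misses the chosen lift of the
  head.\<close>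

locale lifted_network =
  fixes N :: "('v::finite, 'e) network" and pos :: "'v \<Rightarrow> complex" and arc_of :: "'e \<Rightarrow> real \<Rightarrow> complex"
    and r R :: real and vlift :: "'v \<Rightarrow> complex" and elift :: "'e \<Rightarrow> real \<Rightarrow> complex" and k :: "'e \<Rightarrow> int"
  assumes net: "is_network N" and r: "0 < r" "r < R"
    and emb: "embedded_on_annulus N pos arc_of r R"
    and exp_vlift: "exp (vlift v) = pos v"
    and path_elift: "e \<in> edges N \<Longrightarrow> path (elift e)"
    and exp_elift: "e \<in> edges N \<Longrightarrow> 0 \<le> t \<Longrightarrow> t \<le> 1 \<Longrightarrow> exp (elift e t) = arc_of e t"
    and elift_0: "e \<in> edges N \<Longrightarrow> elift e 0 = vlift (tail N e)"
    and elift_1: "e \<in> edges N \<Longrightarrow> elift e 1 = vlift (head N e) + deck (k e)"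
begin

definition vpoint :: "'v \<times> int \<Rightarrow> complex" where
  "vpoint x = vlift (fst x) + deck (snd x)"

text \<open>Every open edge is assigned to the cell of its tail, so that disjoint vertex sets have disjoint cells.\<close>

definition cells :: "('v \<times> int) set \<Rightarrow> complex set" where
  "cells S = vpoint ` S \<union>
     {elift e t + deck n | e t n. e \<in> edges N \<and> 0 < t \<and> t < 1 \<and> (tail N e, n) \<in> S}"

text \<open>Applying \<open>exp\<close> to a common point gives a point of the drawing, which
  determines the vertex, or the edge and its parameter. The level is then recovered because distinct
  deck translations differ.\<close>

lemma cells_disjoint:
  assumes "S \<inter> T = {}"
  shows "cells S \<inter> cells T = {}"
proof -
  have arc: "arc_of e t \<noteq> pos v" if "e \<in> edges N" "0 < t" "t < 1" for e t v
    using emb that unfolding embedded_on_annulus_def by (metis disjoint_iff greaterThanLessThan_iff image_eqI rangeI)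
  have edge: "e = e' \<and> t = t'"
    if "e \<in> edges N" "e' \<in> edges N" "0 < t" "t < 1" "0 < t'" "t' < 1" "arc_of e t = arc_of e' t'" for e e' t t'
  proof -
    have "e = e'"
    proof (rule ccontr)
      assume "e \<noteq> e'"
      then have "arc_of e ` {0<..<1} \<inter> arc_of e' ` {0<..<1} = {}"
        using emb that by (auto simp: embedded_on_annulus_def)
      moreover have "arc_of e t \<in> arc_of e ` {0<..<1}" using that(3,4) by (intro imageI) simp
      moreover have "arc_of e t \<in> arc_of e' ` {0<..<1}"
        unfolding that(7) using that(5,6) by (intro imageI) simp
      ultimately show False by blast
    qed
    moreover have "simple_path (arc_of e)" using emb that by (auto simp: embedded_on_annulus_def)
    ultimately show ?thesis
      using that unfolding simple_path_def loop_free_def by (metis atLeastAtMost_iff less_eq_real_def less_irrefl)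
  qed
  have exp_v: "exp (vpoint x) = pos (fst x)" for x
    by (simp add: vpoint_def exp_add_deck exp_vlift)
  have exp_e: "exp (elift e t + deck n) = arc_of e t" if "e \<in> edges N" "0 < t" "t < 1" for e t n
    using that by (simp add: exp_add_deck exp_elift)
  have vv: "x = y" if "vpoint x = vpoint y" for x y
  proof -
    have "pos (fst x) = pos (fst y)" using that exp_v by metis
    then have "fst x = fst y" using emb by (simp add: embedded_on_annulus_def inj_eq)
    then show ?thesis using that by (simp add: vpoint_def deck_inject prod_eq_iff)
  qed
  have ve: "vpoint x \<noteq> elift e t + deck n" if "e \<in> edges N" "0 < t" "t < 1" for x e t n
    using arc[OF that] exp_v exp_e[OF that] by metis
  have ee: "e = e' \<and> n = n'"
    if "e \<in> edges N" "e' \<in> edges N" "0 < t" "t < 1" "0 < t'" "t' < 1"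
      "elift e t + deck n = elift e' t' + deck n'" for e e' t t' n n'
  proof -
    have "arc_of e t = arc_of e' t'" using exp_e that by metis
    then have "e = e' \<and> t = t'" using edge that by blast
    then show ?thesis using that by (simp add: deck_inject)
  qed
  show ?thesis
  proof (rule equals0I)
    fix x assume "x \<in> cells S \<inter> cells T"
    then consider s t where "s \<in> S" "t \<in> T" "x = vpoint s" "x = vpoint t"
      | s e t n where "x = vpoint s" "x = elift e t + deck n" "e \<in> edges N" "0 < t" "t < 1"
      | e t n e' t' n' where "x = elift e t + deck n" "x = elift e' t' + deck n'" "e \<in> edges N" "e' \<in> edges N"
        "0 < t" "t < 1" "0 < t'" "t' < 1" "(tail N e, n) \<in> S" "(tail N e', n') \<in> T"
      unfolding cells_def by blast
    then show False
    proof cases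
      case 1
      then show ?thesis using vv assms by blast
    next
      case 2
      then show ?thesis using ve by metis
    next
      case 3
      then show ?thesis using ee[of e e' t t' n n'] assms by auto
    qed
  qed
qed

lemma edge_in_cells:
  assumes e: "e \<in> edges N" and S: "(tail N e, n) \<in> S" "(head N e, n + k e) \<in> S"
  shows "path_component (cells S) (vpoint (tail N e, n)) (vpoint (head N e, n + k e))"
  unfolding path_component_def
proof (intro exI conjI)
  define g where "g = (\<lambda>t. elift e t + deck n)"
  show "path g" using path_elift[OF e] unfolding g_def path_def by (intro continuous_intros)
  show g0: "pathstart g = vpoint (tail N e, n)"
    by (simp add: g_def pathstart_def vpoint_def elift_0[OF e])
  show g1: "pathfinish g = vpoint (head N e, n + k e)"
    by (simp add: g_def pathfinish_def vpoint_def elift_1[OF e] deck_simps)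
  show "path_image g \<subseteq> cells S"
  proof
    fix x assume "x \<in> path_image g"
    then obtain t where t: "0 \<le> t" "t \<le> 1" "x = g t" by (auto simp: path_image_def)
    consider "t = 0" | "t = 1" | "0 < t" "t < 1" using t by linarith
    then show "x \<in> cells S"
    proof cases
      case 1
      then have "x = vpoint (tail N e, n)" using t(3) g0 by (simp add: pathstart_def)
      then show ?thesis using S by (simp add: cells_def)
    next
      case 2
      then have "x = vpoint (head N e, n + k e)" using t(3) g1 by (simp add: pathfinish_def)
      then show ?thesis using S by (simp add: cells_def)
    next
      case 3
      then show ?thesis using e S t(3) unfolding cells_def g_def by blast
    qed
  qed
qed

lemma linked_in_cells:
  "linked N k S x y \<Longrightarrow> path_component (cells S) (vpoint x) (vpoint y)"
proof (induction rule: linked_induct)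
  case refl
  then show ?case by (intro path_component_refl) (simp add: cells_def)
next
  case (step d n)
  obtain e b where d: "d = (e, b)" "e \<in> edges N" using step(2) by (auto simp: darts_def)
  have mem: "(dart_tail N d, n) \<in> S" using linked_in[OF step(1)] by blast
  have "path_component (cells S) (vpoint (dart_tail N d, n)) (vpoint (dart_head N d, n + dart_gain k d))"
  proof (cases b)
    case True
    then show ?thesis using edge_in_cells[OF d(2), of n S] mem step(3) d(1)
      by (simp add: dart_tail_def dart_head_def dart_gain_def)
  next
    case False
    then show ?thesis
      using path_component_sym[OF edge_in_cells[OF d(2), of "n - k e" S]] mem step(3) d(1)
      by (simp add: dart_tail_def dart_head_def dart_gain_def)
  qed
  with step(4) show ?case by (rule path_component_trans)
qed

text \<open>One period of the lifted drawing is compact, so \<open>Re\<close> attains a maximum at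
  some \<open>q\<close>, and deck translations preserve \<open>Re\<close>. If \<open>q\<close> is
  interior to an edge, \<open>a\<close> is its tail: the open edge belongs to the cell of the tail,
  so \<open>q\<close> is reached without asking whether the head lies in \<open>S\<close>.\<close>

lemma rightmost_point:
  obtains a q M where "\<And>x. x \<in> cells UNIV \<Longrightarrow> Re x \<le> M" "Re q = M"
    "\<And>S n. (a, n) \<in> S \<Longrightarrow> path_component (cells S) (vpoint (a, n)) (q + deck n)"
proof -
  have fin: "finite (edges N)" using net by (simp add: is_network_def)
  define K where "K = range vlift \<union> (\<Union>e\<in>edges N. path_image (elift e))"
  have "compact (path_image (elift e))" if "e \<in> edges N" for e
    using path_elift[OF that] by (rule compact_path_image)
  then have "compact (\<Union>e\<in>edges N. path_image (elift e))" using fin by (intro compact_UN)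
  moreover have "compact (range vlift)" by (rule finite_imp_compact) simp
  ultimately have "compact K" unfolding K_def by (intro compact_Un)
  moreover have "K \<noteq> {}" by (auto simp: K_def)
  moreover have "continuous_on K Re" by (intro continuous_intros)
  ultimately have "\<exists>x\<in>K. \<forall>y\<in>K. Re y \<le> Re x" by (rule continuous_attains_sup)
  then obtain q where q: "q \<in> K" "\<And>x. x \<in> K \<Longrightarrow> Re x \<le> Re q" by blast
  have le: "Re x \<le> Re q" if x: "x \<in> cells UNIV" for x
  proof -
    consider v n where "x = vlift v + deck n" | e t n where "e \<in> edges N" "0 < t" "t < 1" "x = elift e t + deck n"
      using x unfolding cells_def vpoint_def by auto
    then obtain y n where "y \<in> K" "x = y + deck n"
    proof cases
      case (1 v n)
      moreover have "vlift v \<in> K" by (simp add: K_def)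
      ultimately show ?thesis using that by blast
    next
      case (2 e t n)
      then have "elift e t \<in> path_image (elift e)" unfolding path_image_def by (intro imageI) simp
      then have "elift e t \<in> K" using 2(1) unfolding K_def by blast
      then show ?thesis using that 2(4) by blast
    qed
    then show ?thesis using q(2)[of y] by (simp add: deck_simps)
  qed
  consider v where "Re (vlift v) = Re q" | e t where "e \<in> edges N" "0 < t" "t < 1" "q = elift e t"
  proof -
    consider v where "q = vlift v" | e t where "e \<in> edges N" "0 \<le> t" "t \<le> 1" "q = elift e t"
      using q(1) by (auto simp: K_def path_image_def)
    then show ?thesis
    proof cases
      case (1 v)
      then show ?thesis using that(1)[of v] by simp
    next
      case (2 e t)
      consider "t = 0" | "t = 1" | "0 < t" "t < 1" using 2 by linarith
      then show ?thesis
      proof cases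
        case 1
        then have "Re (vlift (tail N e)) = Re q" using 2 elift_0[OF 2(1)] by simp
        then show ?thesis by (rule that)
      next
        case t1: 2
        then have "Re (vlift (head N e)) = Re q" using 2 elift_1[OF 2(1)] by (simp add: deck_simps)
        then show ?thesis by (rule that)
      next
        case 3
        then show ?thesis using 2 that(2) by blast
      qed
    qed
  qed
  then show ?thesis
  proof cases
    case (1 v)
    have "path_component (cells S) (vpoint (v, n)) (vlift v + deck n)" if "(v, n) \<in> S" for S n
    proof -
      have "vlift v + deck n = vpoint (v, n)" by (simp add: vpoint_def)
      moreover have "vpoint (v, n) \<in> cells S" using that by (simp add: cells_def)
      ultimately show ?thesis by (simp add: path_component_refl)
    qed
    then show ?thesis using that[OF le 1] by blast
  next
    case (2 e t)
    have "path_component (cells S) (vpoint (tail N e, n)) (q + deck n)" if "(tail N e, n) \<in> S" for S n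
      unfolding path_component_def
    proof (intro exI conjI)
      define g where "g = (\<lambda>s. elift e (s * t) + deck n)"
      show "path g"
        unfolding g_def path_def using 2
        by (intro continuous_intros continuous_on_compose2[OF path_elift[OF 2(1), unfolded path_def]])
           (auto simp: mult_le_one)
      show "pathstart g = vpoint (tail N e, n)"
        by (simp add: g_def pathstart_def vpoint_def elift_0[OF 2(1)])
      show "pathfinish g = q + deck n" by (simp add: g_def pathfinish_def 2(4))
      show "path_image g \<subseteq> cells S"
      proof
        fix x assume "x \<in> path_image g"
        then obtain s where s: "0 \<le> s" "s \<le> 1" "x = g s" by (auto simp: path_image_def)
        show "x \<in> cells S"
        proof (cases "s = 0")
          case True
          then have "x = vpoint (tail N e, n)" using s(3) by (simp add: g_def vpoint_def elift_0[OF 2(1)])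
          then show ?thesis using that by (simp add: cells_def)
        next
          case False
          then have "0 < s * t" "s * t \<le> t" using s 2 by (auto simp: mult_left_le_one_le)
          then have "0 < s * t" "s * t < 1" using 2(3) by auto
          then show ?thesis using s(3) 2(1) that unfolding cells_def g_def by blast
        qed
      qed
    qed
    then show ?thesis using that[OF le refl] by blast
  qed
qed

lemma cells_mono: "S \<subseteq> T \<Longrightarrow> cells S \<subseteq> cells T"
  unfolding cells_def by blast

text \<open>Links are realised by paths in the cells and prolonged to translates of the rightmost
  point. These paths have interlaced ends on the boundary of a half plane, so they meet, and cells
  meet only if the vertex sets do.\<close>

lemma crossing_vertex:
  "\<exists>a. \<forall>S T n\<^sub>1 n\<^sub>2 n\<^sub>3 n\<^sub>4. linked N k S (a, n\<^sub>1) (a, n\<^sub>3) \<longrightarrow> linked N k T (a, n\<^sub>2) (a, n\<^sub>4) \<longrightarrow>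
     n\<^sub>1 < n\<^sub>2 \<longrightarrow> n\<^sub>2 < n\<^sub>3 \<longrightarrow> n\<^sub>3 < n\<^sub>4 \<longrightarrow> S \<inter> T \<noteq> {}"
proof -
  obtain a q M where M: "\<And>x. x \<in> cells UNIV \<Longrightarrow> Re x \<le> M" "Re q = M"
    "\<And>S n. (a, n) \<in> S \<Longrightarrow> path_component (cells S) (vpoint (a, n)) (q + deck n)"
    using rightmost_point by metis
  have path: "\<exists>g. path g \<and> path_image g \<subseteq> cells S \<and> pathstart g = q + deck n \<and> pathfinish g = q + deck m"
    if l: "linked N k S (a, n) (a, m)" for S n m
  proof -
    have "(a, n) \<in> S" "(a, m) \<in> S" using linked_in[OF l] by auto
    then have "path_component (cells S) (q + deck n) (q + deck m)"
      using path_component_trans[OF path_component_trans[OF path_component_sym[OF M(3)] linked_in_cells[OF l]] M(3)]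
      by blast
    then show ?thesis by (simp add: path_component_def)
  qed
  have "S \<inter> T \<noteq> {}"
    if S: "linked N k S (a, n1) (a, n3)" and T: "linked N k T (a, n2) (a, n4)"
      and n: "n1 < n2" "n2 < n3" "n3 < n4" for S T n1 n2 n3 n4
  proof -
    obtain g where g: "path g" "path_image g \<subseteq> cells S" "pathstart g = q + deck n1" "pathfinish g = q + deck n3"
      using path[OF S] by blast
    obtain h where h: "path h" "path_image h \<subseteq> cells T" "pathstart h = q + deck n2" "pathfinish h = q + deck n4"
      using path[OF T] by blast
    have "path_image g \<inter> path_image h \<noteq> {}"
    proof (rule paths_in_half_plane_cross[OF g(1) _ h(1)])
      show "path_image g \<subseteq> {x. Re x \<le> M}" "path_image h \<subseteq> {x. Re x \<le> M}"
        using g(2) h(2) M(1) cells_mono[of _ UNIV] by blast+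
    qed (use M(2) n g h in \<open>simp_all add: deck_simps\<close>)
    then show ?thesis using cells_disjoint g(2) h(2) by blast
  qed
  then show ?thesis by blast
qed

section \<open>Lifts of walks and their homotopy classes\<close>

lemma arc_in_annulus:
  "e \<in> edges N \<Longrightarrow> 0 \<le> t \<Longrightarrow> t \<le> 1 \<Longrightarrow> arc_of e t \<in> annulus r R"
proof -
  assume "e \<in> edges N" "0 \<le> t" "t \<le> 1"
  then have "arc_of e t \<in> path_image (arc_of e)" "path_image (arc_of e) \<subseteq> annulus r R"
    using emb by (auto simp: embedded_on_annulus_def path_image_def)
  then show ?thesis by blast
qed

text \<open>This ties the combinatorial gain to topology: the level reached by the lifted walk is
  the starting level plus the gain.\<close>

lemma walk_lift:
  "walk N v ds w \<Longrightarrow> \<exists>p. path p \<and> pathstart p = vpoint (v, n) \<and> pathfinish p = vpoint (w, n + gain k ds) \<and>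
     (\<forall>t\<in>{0..1}. exp (p t) = walk_path N pos arc_of v ds t \<and> walk_path N pos arc_of v ds t \<in> annulus r R)"
proof (induction ds arbitrary: v n)
  case Nil
  have "pos v \<in> annulus r R" using emb by (auto simp: embedded_on_annulus_def)
  then show ?case using Nil
    by (intro exI[of _ "\<lambda>t. vpoint (v, n)"])
       (simp add: path_def pathstart_def pathfinish_def vpoint_def exp_add_deck exp_vlift)
next
  case (Cons d ds)
  obtain e b where d: "d = (e, b)" "e \<in> edges N" using Cons.prems by (auto simp: darts_def)
  obtain g where g: "path g" "pathstart g = vpoint (v, n)"
    "pathfinish g = vpoint (dart_head N d, n + dart_gain k d)"
    "\<And>t. t \<in> {0..1} \<Longrightarrow> exp (g t) = dart_path arc_of d t \<and> dart_path arc_of d t \<in> annulus r R"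
  proof (cases b)
    case True
    define g where "g = (\<lambda>t. elift e t + deck n)"
    have "path g" using path_elift[OF d(2)] unfolding g_def path_def by (intro continuous_intros)
    moreover have "exp (g t) = dart_path arc_of d t \<and> dart_path arc_of d t \<in> annulus r R" if "t \<in> {0..1}" for t
      using that True arc_in_annulus[OF d(2), of t] exp_elift[OF d(2), of t]
      by (simp add: g_def dart_path_def d exp_add_deck)
    ultimately show ?thesis
      using True Cons.prems elift_0[OF d(2)] elift_1[OF d(2)]
      by (intro that[of g])
         (auto simp: g_def pathstart_def pathfinish_def vpoint_def d dart_tail_def dart_head_def dart_gain_def deck_simps)
  next
    case False
    \<comment> \<open>The forward lift ends \<open>k e\<close> levels above its start, so the
      reversed one begins at level \<open>n\<close> only after a shift by
      \<open>n - k e\<close>.\<close>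
    define g where "g = (\<lambda>t. elift e (1 - t) + deck (n - k e))"
    have "path (reversepath (elift e))" using path_elift[OF d(2)] by simp
    then have "path g" unfolding g_def path_def reversepath_def by (intro continuous_intros)
    moreover have "exp (g t) = dart_path arc_of d t \<and> dart_path arc_of d t \<in> annulus r R" if "t \<in> {0..1}" for t
      using that False arc_in_annulus[OF d(2), of "1 - t"] exp_elift[OF d(2), of "1 - t"]
      by (simp add: g_def dart_path_def d exp_add_deck reversepath_def)
    moreover have "deck (n - k e) = deck n - deck (k e)" using deck_simps(2)[of "n - k e" "k e"] by simp
    ultimately show ?thesis
      using False Cons.prems elift_0[OF d(2)] elift_1[OF d(2)]
      by (intro that[of g])
         (auto simp: g_def pathstart_def pathfinish_def vpoint_def d dart_tail_def dart_head_def dart_gain_def)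
  qed
  obtain p where p: "path p" "pathstart p = vpoint (dart_head N d, n + dart_gain k d)"
    "pathfinish p = vpoint (w, n + dart_gain k d + gain k ds)"
    "\<And>t. t \<in> {0..1} \<Longrightarrow> exp (p t) = walk_path N pos arc_of (dart_head N d) ds t \<and>
      walk_path N pos arc_of (dart_head N d) ds t \<in> annulus r R"
    using Cons.IH[of "dart_head N d" "n + dart_gain k d"] Cons.prems by auto
  have "exp ((g +++ p) t) = walk_path N pos arc_of v (d # ds) t \<and>
      walk_path N pos arc_of v (d # ds) t \<in> annulus r R" if "t \<in> {0..1}" for t
    using g(4)[of "2 * t"] p(4)[of "2 * t - 1"] that by (auto simp: joinpaths_def)
  moreover have "path (g +++ p)" using g p by simp
  ultimately show ?case using g p by (intro exI[of _ "g +++ p"]) (simp add: add.assoc)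
qed

lemma gain_zero_contractible:
  assumes "walk N v ds v" "gain k ds = 0"
  shows "contractible_in (annulus r R) (walk_path N pos arc_of v ds)"
proof -
  obtain p where p: "path p" "pathstart p = vpoint (v, 0)" "pathfinish p = vpoint (v, 0)"
    "\<And>t. t \<in> {0..1} \<Longrightarrow> exp (p t) = walk_path N pos arc_of v ds t \<and> walk_path N pos arc_of v ds t \<in> annulus r R"
    using walk_lift[OF assms(1), of 0] assms(2) by auto
  have "pos v \<in> annulus r R" using emb by (auto simp: embedded_on_annulus_def)
  then have "homotopic_loops (annulus r R) (walk_path N pos arc_of v ds) (\<lambda>t. pos v)"
    using p r by (intro homotopic_loops_exp[where p=p and q="\<lambda>t. vlift v" and n=0])
      (auto simp: deck_simps exp_vlift path_def pathstart_def pathfinish_def)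
  then show ?thesis unfolding contractible_in_def by blast
qed

text \<open>The inner circle lifts to a vertical segment with period \<open>deck 1\<close>, the same
  period as the lifted walk.\<close>

lemma gain_one_generator:
  assumes "walk N v ds v" "gain k ds = 1"
  shows "homotopic_loops (annulus r R) (walk_path N pos arc_of v ds) (circlepath 0 r)"
proof -
  obtain p where p: "path p" "pathstart p = vpoint (v, 0)" "pathfinish p = vpoint (v, 1)"
    "\<And>t. t \<in> {0..1} \<Longrightarrow> exp (p t) = walk_path N pos arc_of v ds t \<and> walk_path N pos arc_of v ds t \<in> annulus r R"
    using walk_lift[OF assms(1), of 0] assms(2) by auto
  define q where "q = (\<lambda>t. complex_of_real (ln r) + of_real t * deck 1)"
  have q: "exp (q t) = circlepath 0 r t" for t unfolding q_def using circlepath_exp r by blast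
  moreover have "exp (q t) \<in> annulus r R" for t
    using r by (subst exp_in_annulus_iff) (auto simp: q_def deck_simps)
  moreover have "path q" unfolding q_def path_def by (intro continuous_intros)
  ultimately show ?thesis
    using p r by (intro homotopic_loops_exp[where p=p and q=q and n=1])
      (auto simp: deck_simps vpoint_def q_def pathstart_def pathfinish_def)
qed

end

text \<open>Each arc has a continuous logarithm because its parameter interval is contractible. It
  is translated to start at the chosen logarithm of the tail; the discrepancy left at the head
  becomes the gain.\<close>

lemma lifted_network_exists:
  fixes N :: "('v::finite, 'e) network"
  assumes "is_network N" "0 < r" "r < R" and emb: "embedded_on_annulus N pos arc_of r R"
  shows "\<exists>vlift elift k. lifted_network N pos arc_of r R vlift elift k"
proof -
  have nz: "x \<noteq> 0" if "x \<in> annulus r R" for x using that assms(2) by (auto simp: annulus_def)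
  define vlift where "vlift v = Ln (pos v)" for v
  have v: "exp (vlift v) = pos v" for v
  proof -
    have "pos v \<in> annulus r R" using emb by (auto simp: embedded_on_annulus_def)
    then show ?thesis using nz unfolding vlift_def by (intro exp_Ln) auto
  qed
  have "\<exists>g j. path g \<and> (\<forall>t. 0 \<le> t \<longrightarrow> t \<le> 1 \<longrightarrow> exp (g t) = arc_of e t) \<and>
    g 0 = vlift (tail N e) \<and> g 1 = vlift (head N e) + deck j" if e: "e \<in> edges N" for e
  proof -
    have arc: "path (arc_of e)" "path_image (arc_of e) \<subseteq> annulus r R"
      "arc_of e 0 = pos (tail N e)" "arc_of e 1 = pos (head N e)"
      using emb e by (auto simp: embedded_on_annulus_def simple_path_def pathstart_def pathfinish_def)
    have "arc_of e t \<noteq> 0" if "t \<in> {0..1}" for t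
      using arc(2) nz that unfolding path_image_def by blast
    then obtain g where g: "continuous_on {0..1} g" "\<And>t. t \<in> {0..1} \<Longrightarrow> arc_of e t = exp (g t)"
      using continuous_logarithm_on_contractible[of "{0..1}" "arc_of e"] arc(1)
      by (metis convex_imp_contractible convex_real_interval(5) path_def)
    have "exp (g 0) = exp (vlift (tail N e))" using g(2)[of 0] arc(3) v by simp
    then obtain i where i: "g 0 = vlift (tail N e) + deck i" using exp_eq_deck by blast
    have "exp (g 1) = exp (vlift (head N e))" using g(2)[of 1] arc(4) v by simp
    then obtain j where j: "g 1 = vlift (head N e) + deck j" using exp_eq_deck by blast
    define h where "h = (\<lambda>t. g t + deck (- i))"
    have "path h" unfolding h_def path_def using g(1) by (intro continuous_intros)
    moreover have "exp (h t) = arc_of e t" if "0 \<le> t" "t \<le> 1" for t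
      using g(2)[of t] that by (simp add: h_def exp_add_deck)
    moreover have "h 0 = vlift (tail N e)" using i by (simp add: h_def deck_simps)
    moreover have "h 1 = vlift (head N e) + deck (j + - i)"
      using j unfolding deck_simps(2) by (simp add: h_def)
    ultimately show ?thesis by blast
  qed
  then obtain elift k where "\<And>e. e \<in> edges N \<Longrightarrow> path (elift e) \<and>
    (\<forall>t. 0 \<le> t \<longrightarrow> t \<le> 1 \<longrightarrow> exp (elift e t) = arc_of e t) \<and>
    elift e 0 = vlift (tail N e) \<and> elift e 1 = vlift (head N e) + deck (k e)"
    by metis
  then have "lifted_network N pos arc_of r R vlift elift k"
    using assms v by unfold_locales auto
  then show ?thesis by blast
qed

section \<open>Flat connections are determined by gains\<close>

text \<open>A gauge change is conjugation by a diagonal matrix.\<close>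

lemma det_gauge:
  fixes M :: "complex ^ 'n ^ 'n"
  assumes g: "\<And>u. g u \<noteq> 0"
  shows "det (\<chi> u v. g u * M $ u $ v / g v) = det M"
proof -
  have "det (\<chi> u v. g u * M $ u $ v / g v) = prod g UNIV * det (\<chi> u v. M $ u $ v / g v)"
    unfolding det_rows_mul[symmetric] by (rule arg_cong[of _ _ det]) (simp add: vec_eq_iff)
  also have "det (\<chi> u v. M $ u $ v / g v) = det (\<chi> v. inverse (g v) *s transpose M $ v)"
    by (subst det_transpose[symmetric], rule arg_cong[of _ _ det])
       (simp add: vec_eq_iff transpose_def divide_inverse)
  also have "\<dots> = prod (\<lambda>v. inverse (g v)) UNIV * det (transpose M)"
    unfolding det_rows_mul by (simp add: vec_eq_iff)
  finally have "det (\<chi> u v. g u * M $ u $ v / g v) =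
      (prod g UNIV * prod (\<lambda>v. inverse (g v)) UNIV) * det M"
    by (simp add: det_transpose mult.assoc)
  also have "prod g UNIV * prod (\<lambda>v. inverse (g v)) UNIV = 1"
    unfolding prod.distrib[symmetric] using g by simp
  finally show ?thesis by simp
qed

section \<open>Monodromy along walks and the gauge transformation\<close>

lemma monodromy_simps:
  "monodromy \<phi> [] = 1" "monodromy \<phi> (d # ds) = \<phi> d * monodromy \<phi> ds"
  "monodromy \<phi> (ds @ es) = monodromy \<phi> ds * monodromy \<phi> es"
  by (simp_all add: monodromy_def)

lemma monodromy_rev_walk:
  assumes "connection N \<phi>"
  shows "walk N u ds v \<Longrightarrow> monodromy \<phi> ds \<noteq> 0 \<and> monodromy \<phi> (rev_walk ds) = inverse (monodromy \<phi> ds)"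
proof (induction ds arbitrary: u)
  case (Cons d ds)
  then have "\<phi> d \<noteq> 0" "\<phi> (rev_dart d) = inverse (\<phi> d)" using assms by (auto simp: connection_def)
  then show ?case using Cons by (auto simp: monodromy_simps)
qed (simp add: monodromy_simps)

context lifted_network
begin

lemma annular:
  assumes "\<exists>v ds. walk N v ds v \<and> gain k ds \<noteq> 0"
  shows "\<exists>a. annular_network N k a"
proof -
  obtain a where a: "\<And>S T n\<^sub>1 n\<^sub>2 n\<^sub>3 n\<^sub>4. linked N k S (a, n\<^sub>1) (a, n\<^sub>3) \<Longrightarrow> linked N k T (a, n\<^sub>2) (a, n\<^sub>4) \<Longrightarrow>
     n\<^sub>1 < n\<^sub>2 \<Longrightarrow> n\<^sub>2 < n\<^sub>3 \<Longrightarrow> n\<^sub>3 < n\<^sub>4 \<Longrightarrow> S \<inter> T \<noteq> {}"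
    using crossing_vertex by blast
  have "annular_network N k a"
  proof
    show "finite (edges N)" "\<And>u v. \<exists>ds. walk N u ds v" using net by (auto simp: is_network_def)
    show "\<exists>v ds. walk N v ds v \<and> gain k ds \<noteq> 0" by (rule assms)
  qed (rule a)
  then show ?thesis by blast
qed

text \<open>Flatness prescribes the monodromy for gains 0 and 1. A closed walk of other gain is
  brought one step closer to gain 0 by appending a closed walk of gain 1 or its reverse.\<close>

lemma monodromy_gain:
  assumes flat: "flat_connection N pos arc_of r R \<phi> z" and z: "z \<noteq> 0"
  shows "walk N v ds v \<Longrightarrow> monodromy \<phi> ds = z powi gain k ds"
proof (induction "nat \<bar>gain k ds\<bar>" arbitrary: ds)
  case 0
  then have "gain k ds = 0" by simp
  then show ?case using gain_zero_contractible[OF 0(2)] flat 0(2) by (simp add: flat_connection_def)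
next
  case (Suc m)
  have "gain k ds \<noteq> 0" using Suc(2) by auto
  then obtain a where "annular_network N k a" using annular Suc(3) by blast
  then obtain es where es: "walk N v es v" "gain k es = 1"
    using annular_network.closed_walk_gain_one by blast
  have z_es: "monodromy \<phi> es = z"
    using flat es(1) gain_one_generator[OF es] by (simp add: flat_connection_def)
  have con: "connection N \<phi>" using flat by (simp add: flat_connection_def)
  show ?case
  proof (cases "gain k ds > 0")
    case True
    define ds' where "ds' = ds @ rev_walk es"
    have g: "gain k ds' = gain k ds - 1" using es by (simp add: ds'_def)
    have "m = nat \<bar>gain k ds'\<bar>" using True Suc(2) unfolding g by linarith
    moreover have "walk N v ds' v" using Suc(3) walk_rev[OF es(1)] by (auto simp: ds'_def walk_append)
    ultimately have "monodromy \<phi> ds' = z powi (gain k ds - 1)" using Suc(1) g by metis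
    moreover have "monodromy \<phi> ds' = monodromy \<phi> ds * inverse z"
      using monodromy_rev_walk[OF con es(1)] z_es by (simp add: ds'_def monodromy_simps)
    ultimately have "monodromy \<phi> ds = z powi (gain k ds - 1) * z" using z by (simp add: field_simps)
    then show ?thesis using z by (simp add: power_int_diff)
  next
    case False
    define ds' where "ds' = ds @ es"
    have g: "gain k ds' = gain k ds + 1" using es by (simp add: ds'_def)
    have "m = nat \<bar>gain k ds'\<bar>" using False Suc(2) unfolding g by linarith
    moreover have "walk N v ds' v" using Suc(3) es(1) by (auto simp: ds'_def walk_append)
    ultimately have "monodromy \<phi> ds' = z powi (gain k ds + 1)" using Suc(1) g by metis
    moreover have "monodromy \<phi> ds' = monodromy \<phi> ds * z"
      using z_es by (simp add: ds'_def monodromy_simps)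
    ultimately show ?thesis using z by (simp add: power_int_add)
  qed
qed

lemma det_laplacian:
  assumes flat: "flat_connection N pos arc_of r R \<phi> z" and z: "z \<noteq> 0"
  shows "det (matrix (laplacian N \<phi>)) = det (gain_laplacian N k (conductance N) z)"
proof -
  have con: "connection N \<phi>" using flat by (simp add: flat_connection_def)
  have fin: "finite (edges N)" and "\<exists>ds. walk N u ds v" for u v
    using net by (auto simp: is_network_def)
  \<comment> \<open>The arbitrary vertex \<open>undefined\<close> serves as base point. The gauge
    \<open>g\<close> compares the actual transport from it along \<open>W v\<close> with the model
    transport by powers of \<open>z\<close>.\<close>
  then obtain W where W: "\<And>v. walk N (undefined :: 'v) (W v) v" by metis
  define g where "g v = monodromy \<phi> (W v) * z powi (- gain k (W v))" for v
  have g0: "g v \<noteq> 0" for v using monodromy_rev_walk[OF con W] z by (simp add: g_def)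
  have \<phi>: "\<phi> (rev_dart d) = z powi (- dart_gain k d) * g (dart_tail N d) / g (dart_head N d)"
    if d: "d \<in> darts N" for d
  proof -
    define u where "u = dart_tail N d"
    define v where "v = dart_head N d"
    \<comment> \<open>The closed walk from the base point out to \<open>v\<close>, back across the
      dart to \<open>u\<close>, and home; its known monodromy expresses the transport across the
      dart.\<close>
    define ds where "ds = W v @ rev_dart d # rev_walk (W u)"
    have "walk N undefined ds undefined"
      using W[of v] walk_rev[OF W[of u]] d by (auto simp: ds_def walk_append u_def v_def)
    then have "monodromy \<phi> ds = z powi gain k ds" by (rule monodromy_gain[OF flat z])
    moreover define A where "A = z powi gain k (W v)"
    moreover define B where "B = z powi (- dart_gain k d)"
    moreover define C where "C = z powi (- gain k (W u))"
    ultimately have "monodromy \<phi> (W v) * (\<phi> (rev_dart d) * inverse (monodromy \<phi> (W u))) = A * (B * C)"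
      using monodromy_rev_walk[OF con W[of u]] z
      by (simp add: ds_def monodromy_simps flip: power_int_add)
    then have eq: "monodromy \<phi> (W v) * \<phi> (rev_dart d) = A * (B * C) * monodromy \<phi> (W u)"
      using monodromy_rev_walk[OF con W[of u]] by (simp add: field_simps)
    have A: "A \<noteq> 0" using z by (simp add: A_def)
    have Wv: "monodromy \<phi> (W v) = A * g v" using A by (simp add: g_def A_def power_int_minus)
    have gu: "g u = C * monodromy \<phi> (W u)" by (simp add: g_def C_def)
    have "A * (\<phi> (rev_dart d) * g v) = A * (B * g u)"
      using eq unfolding Wv gu by (simp only: mult_ac)
    then have "\<phi> (rev_dart d) * g v = B * g u" using A by simp
    then show ?thesis using g0 by (simp add: field_simps u_def v_def B_def)
  qed
  have L: "matrix (laplacian N \<phi>) = (\<chi> u v. g u * gain_laplacian N k (conductance N) (1 / z) $ u $ v / g v)"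
  proof -
    have "of_real (conductance N (fst d)) * (axis v 1 $ u - \<phi> (rev_dart d) * axis v 1 $ dart_head N d) =
      g u * (of_real (conductance N (fst d)) * ((if u = v then 1 else 0) -
          (1 / z) powi dart_gain k d * (if dart_head N d = v then 1 else 0))) / g v"
      if "d \<in> darts N" "dart_tail N d = u" for d u v
    proof -
      have "(1 / z) powi dart_gain k d = z powi (- dart_gain k d)"
        by (simp add: power_int_minus power_int_divide_distrib inverse_eq_divide)
      then show ?thesis
        unfolding \<phi>[OF that(1)] that(2) using g0[of v] by (auto simp: axis_def field_simps)
    qed
    then show ?thesis
      unfolding matrix_def laplacian_def gain_laplacian_def vec_eq_iff vec_lambda_beta
        sum_distrib_left sum_divide_distrib
      by (intro allI sum.cong) auto
  qed
  \<comment> \<open>The inverse appears because \<open>laplacian\<close> transports along the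
    reversed dart, whereas \<open>gain_laplacian\<close> uses the gain of the dart itself;
    reciprocity removes it.\<close>
  have "det (matrix (laplacian N \<phi>)) = det (gain_laplacian N k (conductance N) (1 / z))"
    unfolding L by (rule det_gauge[OF g0])
  then show ?thesis using det_gain_laplacian_inverse[OF fin z] by simp
qed

end

text \<open>If every closed walk is contractible, the connection is gauge trivial and the
  determinant vanishes identically, so the claims about roots are conditional. Roots are taken away
  from 0 because \<open>p\<close> is fixed only up to a power of \<open>z\<close>.\<close>

theorem theorem6p1:
  fixes N :: "('v::finite, 'e) network"
    and pos :: "'v \<Rightarrow> complex"
    and arc_of :: "'e \<Rightarrow> real \<Rightarrow> complex"
    and r R :: real
    and \<Phi> :: "complex \<Rightarrow> 'e dart \<Rightarrow> complex"
    and P :: "complex \<Rightarrow> complex"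
  assumes "is_network N"
    and "0 < r" and "r < R"
    and "embedded_on_annulus N pos arc_of r R"
    and "\<And>z. z \<noteq> 0 \<Longrightarrow> flat_connection N pos arc_of r R (\<Phi> z) z"
    and "\<And>z. z \<noteq> 0 \<Longrightarrow> P z = det (matrix (laplacian N (\<Phi> z)))"
  shows "(\<forall>z. z \<noteq> 0 \<longrightarrow> P z = P (1 / z)) \<and>
    (\<exists>(p :: complex poly) (n :: nat).
       (\<forall>z. z \<noteq> 0 \<longrightarrow> P z = poly p z / z ^ n) \<and>
       (has_noncontractible_cycle N pos arc_of r R \<longrightarrow>
          p \<noteq> 0 \<and>
          (\<forall>a. a \<noteq> 0 \<and> poly p a = 0 \<longrightarrow> a \<in> \<real> \<and> Re a > 0) \<and>
          order 1 p = 2 \<and>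
          (\<forall>a. a \<noteq> 0 \<and> a \<noteq> 1 \<and> poly p a = 0 \<longrightarrow> order a p = 1)))"
proof -
  obtain vlift elift k where "lifted_network N pos arc_of r R vlift elift k"
    using lifted_network_exists assms(1-4) by blast
  then interpret lifted_network N pos arc_of r R vlift elift k .
  have fin: "finite (edges N)" and c: "positive_on_edges N (conductance N)"
    using net by (auto simp: is_network_def positive_on_edges_def)
  have P: "P z = det (gain_laplacian N k (conductance N) z)" if "z \<noteq> 0" for z
    using assms(5,6) det_laplacian that by metis
  obtain p n where pn: "\<And>z. z \<noteq> 0 \<Longrightarrow> det (gain_laplacian N k (conductance N) z) = poly p z / z ^ n"
    using det_gain_laplacian_poly[OF fin] by metis
  show ?thesis
  proof (intro conjI exI[of _ p] exI[of _ n] impI allI)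
    show "P z = P (1 / z)" if "z \<noteq> 0" for z
      using P that det_gain_laplacian_inverse[OF fin that] by simp
    show "P z = poly p z / z ^ n" if "z \<noteq> 0" for z using P pn that by simp
    assume "has_noncontractible_cycle N pos arc_of r R"
    then have "\<exists>v ds. walk N v ds v \<and> gain k ds \<noteq> 0"
      using gain_zero_contractible unfolding has_noncontractible_cycle_def by blast
    then obtain a where "annular_network N k a" using annular by blast
    note roots = annular_network.det_gain_laplacian_roots[OF this c pn]
    show "p \<noteq> 0" "order 1 p = 2" using roots by blast+
    fix x
    show "x \<in> \<real>" "Re x > 0" if "x \<noteq> 0 \<and> poly p x = 0" using roots that by blast+
    show "order x p = 1" if "x \<noteq> 0 \<and> x \<noteq> 1 \<and> poly p x = 0" using roots that by blast
  qed
qed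

end
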